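(* For every integer $d\ge 1$ there are constants $c_d,C_d>0$, depending only on $d$, such that the following holds. Let $P(\lambda)=\sum_{i=0}^d A_i\lambda^i$ be a regular $n\times n$ complex matrix polynomial of degree $d$. Assume $d$ is divisible both by $\ell\ge1$ and $r\ge1$, let $\mathcal{L}(\lambda)$ be a block Kronecker companion $\ell$-ification of $P(\lambda)$, and let $\mathcal{R}(\lambda)$ be a block Kronecker companion $r$-ification of $P(\lambda)$. Assume that $P(\lambda)$ has been scaled so that $\max_{0\le i\le d}\|A_i\|_2=1$. If $\lambda_0$ is a finite, nonzero and simple eigenvalue of $P(\lambda)$, then $$\frac{\mathrm{coeff\,cond}_{\mathcal{R}}(\lambda_0)}{\mathrm{coeff\,cond}_{\mathcal{L}}(\lambda_0)}\approx 1,\qquad\text{in the sense that}\qquad c_d\le\frac{\mathrm{coeff\,cond}_{\mathcal{R}}(\lambda_0)}{\mathrm{coeff\,cond}_{\mathcal{L}}(\lambda_0)}\le C_d .$$ In other words, under the scaling assumption $\max_{0\le i\le d}\|A_i\|_2=1$, no block Kronecker companion form is much better or much worse conditioned than any other block Kronecker companion form.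
   Context: A matrix polynomial $P(\lambda)=\sum_{i=0}^d A_i\lambda^i$, $A_i\in\mathbb{C}^{n\times n}$, is regular if $\det P(\lambda)\not\equiv 0$; it has degree $d$ if $A_d\ne0$. Right/left eigenvectors of a matrix polynomial $Q$ for an eigenvalue $\lambda_0$ are nonzero $z,w$ with $Q(\lambda_0)z=0$, $w^*Q(\lambda_0)=0$. Condition number: for a matrix polynomial $\mathcal{L}(\lambda)=\sum_{i=0}^\ell\mathcal{L}_i\lambda^i$ and a simple, finite, nonzero eigenvalue $\lambda_0$ with right and left eigenvectors $z,w$, $$\mathrm{coeff\,cond}_{\mathcal{L}}(\lambda_0)=\frac{\left(\sum_{i=0}^\ell|\lambda_0|^i\|\mathcal{L}_i\|_2\right)\|z\|_2\|w\|_2}{|\lambda_0|\,|w^*\mathcal{L}'(\lambda_0)z|};$$ similarly for $\mathcal{R}(\lambda)=\sum_{i=0}^r\mathcal{R}_i\lambda^i$. (Simple eigenvalues of $P$ are simple eigenvalues of $\mathcal{L}$ and $\mathcal{R}$.) For $k\ge0$, $L_k(\lambda)$ is the $k\times(k+1)$ matrix with entries $-1$ at positions $(i,i)$, $\lambda$ at positions $(i,i+1)$, and $0$ elsewhere ($L_0$ is the empty $0\times1$ matrix, and the corresponding block row/column below is absent), and $\Lambda_k(\lambda)=[\lambda^k\ \lambda^{k-1}\ \cdots\ \lambda\ 1]^T$. $\otimes$ is the Kronecker product. Block Kronecker companion form: let $\ell$ divide $d$ and let $\epsilon,\eta\ge0$ be integers with $\epsilon+\eta+1=d/\ell$. An $(\epsilon,n,\eta,n)$-block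 Kronecker $\ell$-ification of $P$ is a matrix polynomial $$\mathcal{L}(\lambda)=\begin{bmatrix} M(\lambda) & L_\eta(\lambda^\ell)^T\otimes I_n\\ L_\epsilon(\lambda^\ell)\otimes I_n & 0\end{bmatrix},\qquad M(\lambda)=\sum_{t=0}^\ell M_t\lambda^t\in\mathbb{C}[\lambda]^{(\eta+1)n\times(\epsilon+1)n},$$ with $(\Lambda_\eta(\lambda^\ell)^T\otimes I_n)M(\lambda)(\Lambda_\epsilon(\lambda^\ell)\otimes I_n)=P(\lambda)$. It is a block Kronecker companion form (companion $\ell$-ification) of $P$ if moreover, viewing each $M_t$ as an $(\eta+1)\times(\epsilon+1)$ block matrix with $n\times n$ blocks, every block of every $M_t$ is either $0$, $I_n$, or $A_i$ for some $i\in\{0,\dots,d\}$. Block Kronecker companion $r$-ifications are defined in the same way with $r$ in place of $\ell$.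
   Formalization: The formal theorem also assumes that ℓ = d if and only if r = d: comparing P itself (ℓ = d, no Kronecker blocks) with a companion form of smaller grade, the ratio is unbounded, e.g. for P = −λ²+(1−a)λ+a at λ0 = −a as a → 0. *)

theory Defs
  imports "Jordan_Normal_Form.Determinant"
begin

section \<open>The spectral norm\<close>

definition vec_norm2 :: "complex vec \<Rightarrow> real" where
  "vec_norm2 v = sqrt (\<Sum>i<dim_vec v. (cmod (v $ i))\<^sup>2)"

definition mat_norm2 :: "complex mat \<Rightarrow> real" where
  "mat_norm2 A = Sup {vec_norm2 (A *\<^sub>v v) | v. v \<in> carrier_vec (dim_col A) \<and> vec_norm2 v \<le> 1}"

section \<open>Matrix polynomials\<close>

text \<open>A matrix polynomial is a matrix whose entries are polynomials; its matrix coefficients,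
  its values and its derivative are taken entrywise.\<close>

definition mpoly_coeff :: "complex poly mat \<Rightarrow> nat \<Rightarrow> complex mat" where
  "mpoly_coeff Q i = map_mat (\<lambda>p. coeff p i) Q"

definition mpoly_eval :: "complex poly mat \<Rightarrow> complex \<Rightarrow> complex mat" where
  "mpoly_eval Q x = map_mat (\<lambda>p. poly p x) Q"

definition mpoly_deriv :: "complex poly mat \<Rightarrow> complex poly mat" where
  "mpoly_deriv Q = map_mat pderiv Q"

definition mpoly_has_degree :: "complex poly mat \<Rightarrow> nat \<Rightarrow> bool" where
  "mpoly_has_degree Q d \<longleftrightarrow>
     (\<forall>i>d. mpoly_coeff Q i = 0\<^sub>m (dim_row Q) (dim_col Q)) \<and>
     mpoly_coeff Q d \<noteq> 0\<^sub>m (dim_row Q) (dim_col Q)"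

definition mpoly_regular :: "complex poly mat \<Rightarrow> bool" where
  "mpoly_regular Q \<longleftrightarrow> dim_row Q = dim_col Q \<and> det Q \<noteq> 0"

definition simple_mpoly_eigenvalue :: "complex poly mat \<Rightarrow> complex \<Rightarrow> bool" where
  "simple_mpoly_eigenvalue Q x \<longleftrightarrow> mpoly_regular Q \<and> order x (det Q) = 1"

definition right_eigenvector :: "complex poly mat \<Rightarrow> complex \<Rightarrow> complex vec \<Rightarrow> bool" where
  "right_eigenvector Q x z \<longleftrightarrow>
     z \<in> carrier_vec (dim_col Q) \<and> z \<noteq> 0\<^sub>v (dim_col Q) \<and>
     mpoly_eval Q x *\<^sub>v z = 0\<^sub>v (dim_row Q)"

text \<open>The row vector \<open>w\<^sup>* Q(x)\<close>, written as a column, is \<open>Q(x)\<^sup>T\<close> applied to the conjugate of \<open>w\<close>.\<close>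

definition left_eigenvector :: "complex poly mat \<Rightarrow> complex \<Rightarrow> complex vec \<Rightarrow> bool" where
  "left_eigenvector Q x w \<longleftrightarrow>
     w \<in> carrier_vec (dim_row Q) \<and> w \<noteq> 0\<^sub>v (dim_row Q) \<and>
     transpose_mat (mpoly_eval Q x) *\<^sub>v conjugate w = 0\<^sub>v (dim_col Q)"

text \<open>Here \<open>l\<close> is the grade at which \<open>Q\<close> is considered, and \<open>z\<close>, \<open>w\<close> are a right and a left
  eigenvector for \<open>x\<close>. For a simple eigenvalue the value does not depend on their choice.\<close>

definition coeff_cond ::
  "nat \<Rightarrow> complex poly mat \<Rightarrow> complex \<Rightarrow> complex vec \<Rightarrow> complex vec \<Rightarrow> real" where
  "coeff_cond l Q x z w =
     (\<Sum>i\<le>l. cmod x ^ i * mat_norm2 (mpoly_coeff Q i)) * vec_norm2 z * vec_norm2 w /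
     (cmod x * cmod (conjugate w \<bullet> (mpoly_eval (mpoly_deriv Q) x *\<^sub>v z)))"

section \<open>Block Kronecker companion forms\<close>

definition kronecker :: "'a :: semiring_1 mat \<Rightarrow> 'a mat \<Rightarrow> 'a mat" where
  "kronecker A B = mat (dim_row A * dim_row B) (dim_col A * dim_col B)
     (\<lambda>(i, j). A $$ (i div dim_row B, j div dim_col B) * B $$ (i mod dim_row B, j mod dim_col B))"

definition L_mat :: "nat \<Rightarrow> 'a :: ring_1 \<Rightarrow> 'a mat" where
  "L_mat k x = mat k (k + 1) (\<lambda>(i, j). if j = i then - 1 else if j = i + 1 then x else 0)"

definition Lambda_mat :: "nat \<Rightarrow> 'a :: semiring_1 \<Rightarrow> 'a mat" where
  "Lambda_mat k x = mat (k + 1) 1 (\<lambda>(i, j). x ^ (k - i))"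

definition mat_block :: "nat \<Rightarrow> 'a mat \<Rightarrow> nat \<Rightarrow> nat \<Rightarrow> 'a mat" where
  "mat_block n A i j = mat n n (\<lambda>(a, b). A $$ (i * n + a, j * n + b))"

text \<open>The polynomial \<open>\<lambda>\<^sup>l\<close> is \<open>monom 1 l\<close>. When \<open>\<epsilon> = 0\<close> or \<open>\<eta> = 0\<close> the corresponding block row or
  block column of the four-block matrix has size zero.\<close>

definition block_kronecker_ification ::
  "nat \<Rightarrow> nat \<Rightarrow> nat \<Rightarrow> nat \<Rightarrow> nat \<Rightarrow> complex poly mat \<Rightarrow> complex poly mat \<Rightarrow> complex poly mat \<Rightarrow> bool"
  where
  "block_kronecker_ification d n l \<epsilon> \<eta> P M Q \<longleftrightarrow>
     l dvd d \<and> \<epsilon> + \<eta> + 1 = d div l \<and>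
     M \<in> carrier_mat ((\<eta> + 1) * n) ((\<epsilon> + 1) * n) \<and>
     (\<forall>t>l. mpoly_coeff M t = 0\<^sub>m ((\<eta> + 1) * n) ((\<epsilon> + 1) * n)) \<and>
     kronecker (transpose_mat (Lambda_mat \<eta> (monom 1 l))) (1\<^sub>m n) * M *
       kronecker (Lambda_mat \<epsilon> (monom 1 l)) (1\<^sub>m n) = P \<and>
     Q = four_block_mat
           M (kronecker (transpose_mat (L_mat \<eta> (monom 1 l))) (1\<^sub>m n))
           (kronecker (L_mat \<epsilon> (monom 1 l)) (1\<^sub>m n)) (0\<^sub>m (\<epsilon> * n) (\<eta> * n))"

definition block_kronecker_companion ::
  "nat \<Rightarrow> nat \<Rightarrow> nat \<Rightarrow> complex poly mat \<Rightarrow> complex poly mat \<Rightarrow> bool" where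
  "block_kronecker_companion d n l P Q \<longleftrightarrow>
     (\<exists>\<epsilon> \<eta> M. block_kronecker_ification d n l \<epsilon> \<eta> P M Q \<and>
       (\<forall>t\<le>l. \<forall>i\<le>\<eta>. \<forall>j\<le>\<epsilon>.
          mat_block n (mpoly_coeff M t) i j
            \<in> {0\<^sub>m n n, 1\<^sub>m n} \<union> {mpoly_coeff P k | k. k \<le> d}))"

end

(* If L z = 0, the rows L_eps(x^l) force the first block component of z to be Lambda_eps(x^l) (x) v
   with P(x) v = 0; the remaining component solves a bidiagonal system and is no larger up to a
   constant depending on d. Hence ||z|| ~ Y^eps ||v|| with Y = max(1, |x|^l); transposition gives
   ||w|| ~ Y^eta ||u||. For l < d the identity blocks of L make the weighted norm sum ~ Y, so the
   product of the three is ~ Y^(eps + eta + 1) = max(1, |x|)^d, which no longer depends on l.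
   Since moreover w^* L'(x) z = u^* P'(x) v, the condition number of L is, up to constants,
   max(1, |x|)^d ||u|| ||v|| / (|x| |u^* P'(x) v|), which depends on P and x alone.
   For l = r = d there are no identity blocks, but then L = R = P. *)
theory Submission
  imports Defs "HOL-Analysis.L2_Norm"
begin

subsection \<open>Euclidean and spectral norms\<close>

text \<open>The hypothesis \<open>l = d \<longleftrightarrow> r = d\<close> cannot be dropped. A
  single block has no identity blocks, so its weighted norm sum is that of \<open>P\<close> alone
  and can be far below \<open>max 1 (cmod x) ^ d\<close>. Example: n = 1, d = 2, P(t) = e t^2 + t
  with small e > 0, and x = -1/e. For l = 2 the sum is 2/e, whereas a form with r = 1 contributes at
  least 1/e^2 in its place, so the ratio is at least 1/(2e). The proof must do without explicit
  eigenvectors: of \<open>M\<close> only the norms of its coefficient blocks are controlled, so the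
  second components of \<open>z\<close> and \<open>w\<close> are estimated, never computed. They
  also enter the pairing with the derivative, which is therefore obtained by differentiating a
  polynomial identity in which they are arbitrary. Finally, the two forms yield null vectors of
  \<open>P\<close> that are unrelated a priori. That they are proportional has to be extracted from
  simplicity, which is given only as the order of a zero of the determinant.\<close>

definition cnorm :: "nat \<Rightarrow> (nat \<Rightarrow> complex) \<Rightarrow> real" where
  "cnorm n f = L2_set (\<lambda>i. cmod (f i)) {..<n}"

text \<open>Functions on an initial segment replace vectors: a block is then the index shift
  \<open>\<lambda>a. f (i * n + a)\<close>, free of carrier conditions.\<close>

lemma vec_norm2_eq_cnorm: "vec_norm2 v = cnorm (dim_vec v) (\<lambda>i. v $ i)"
  by (simp add: vec_norm2_def cnorm_def L2_set_def)

lemma cnorm_cong: "(\<And>i. i < n \<Longrightarrow> f i = g i) \<Longrightarrow> cnorm n f = cnorm n g"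
  unfolding cnorm_def by (rule L2_set_cong) auto

lemma cnorm_nonneg [simp]: "0 \<le> cnorm n f"
  by (simp add: cnorm_def)

lemma cnorm_zero [simp]: "cnorm n (\<lambda>i. 0) = 0"
  by (simp add: cnorm_def L2_set_def)

lemma cnorm_eq_0_iff: "cnorm n f = 0 \<longleftrightarrow> (\<forall>i<n. f i = 0)"
  by (auto simp: cnorm_def L2_set_eq_0_iff)

lemma cnorm_add: "cnorm n (\<lambda>i. f i + g i) \<le> cnorm n f + cnorm n g"
proof -
  have "cnorm n (\<lambda>i. f i + g i) \<le> L2_set (\<lambda>i. cmod (f i) + cmod (g i)) {..<n}"
    unfolding cnorm_def by (rule L2_set_mono) (auto simp: norm_triangle_ineq)
  also have "\<dots> \<le> cnorm n f + cnorm n g"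
    unfolding cnorm_def by (rule L2_set_triangle_ineq)
  finally show ?thesis .
qed

lemma cnorm_scale: "cnorm n (\<lambda>i. c * f i) = cmod c * cnorm n f"
  by (simp add: cnorm_def norm_mult L2_set_right_distrib)

lemma cnorm_minus: "cnorm n (\<lambda>i. - f i) = cnorm n f"
  by (simp add: cnorm_def)

lemma cnorm_cnj: "cnorm n (\<lambda>i. cnj (f i)) = cnorm n f"
  by (simp add: cnorm_def)

lemma cnorm_sum: "finite S \<Longrightarrow> cnorm n (\<lambda>i. \<Sum>s\<in>S. f s i) \<le> (\<Sum>s\<in>S. cnorm n (f s))"
proof (induction S rule: finite_induct)
  case (insert x F)
  then show ?case
    using cnorm_add[of n "f x" "\<lambda>i. \<Sum>s\<in>F. f s i"] by simp
qed simp

lemma cnorm_ge_entry: "i < n \<Longrightarrow> cmod (f i) \<le> cnorm n f"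
  unfolding cnorm_def by (rule member_le_L2_set) auto

lemma cmod_dot_le: "cmod (\<Sum>i<n. f i * g i) \<le> cnorm n f * cnorm n g"
proof -
  have "cmod (\<Sum>i<n. f i * g i) \<le> (\<Sum>i<n. \<bar>cmod (f i)\<bar> * \<bar>cmod (g i)\<bar>)"
    by (rule order_trans[OF norm_sum]) (simp add: norm_mult)
  also have "\<dots> \<le> cnorm n f * cnorm n g"
    unfolding cnorm_def by (rule L2_set_mult_ineq)
  finally show ?thesis .
qed

section \<open>Sums and Euclidean norms split into blocks\<close>

lemma sum_blocks:
  fixes f :: "nat \<Rightarrow> 'a :: comm_monoid_add"
  shows "(\<Sum>k<p * n. f k) = (\<Sum>i<p. \<Sum>a<n. f (i * n + a))"
proof (induction p)
  case (Suc p)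
  have "{..<Suc p * n} = {..<p * n} \<union> (\<lambda>a. p * n + a) ` {..<n}"
    by (auto simp: image_iff) (metis add_diff_inverse_nat add.commute less_diff_conv2 not_less lessThan_iff)
  moreover have "{..<p * n} \<inter> (\<lambda>a. p * n + a) ` {..<n} = {}" by auto
  ultimately have "(\<Sum>k<Suc p * n. f k) = (\<Sum>k<p * n. f k) + (\<Sum>k\<in>(\<lambda>a. p * n + a) ` {..<n}. f k)"
    by (simp only:) (rule sum.union_disjoint, auto)
  also have "(\<Sum>k\<in>(\<lambda>a. p * n + a) ` {..<n}. f k) = (\<Sum>a<n. f (p * n + a))"
    by (subst sum.reindex) (auto simp: inj_on_def)
  finally show ?case using Suc by simp
qed simp

lemma sum_lessThan_add:
  fixes f :: "nat \<Rightarrow> 'a :: comm_monoid_add"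
  shows "(\<Sum>k<p + q. f k) = (\<Sum>i<p. f i) + (\<Sum>i<q. f (p + i))"
  by (induction q) (auto simp: add.assoc)

text \<open>The squared norms of the blocks add up, so the norm is the Euclidean norm of the block
  norms, which is at most their sum. The loss is harmless because \<open>p\<close> will be bounded
  in terms of the degree.\<close>

lemma cnorm_blocks_le: "cnorm (p * n) f \<le> (\<Sum>i<p. cnorm n (\<lambda>a. f (i * n + a)))"
proof -
  have eq: "(cnorm (p * n) f)\<^sup>2 = (\<Sum>i<p. (cnorm n (\<lambda>a. f (i * n + a)))\<^sup>2)"
    by (simp add: cnorm_def L2_set_def sum_nonneg sum_blocks)
  then have "cnorm (p * n) f = L2_set (\<lambda>i. cnorm n (\<lambda>a. f (i * n + a))) {..<p}"
    unfolding L2_set_def by (metis cnorm_nonneg real_sqrt_unique)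
  also have "\<dots> \<le> (\<Sum>i<p. cnorm n (\<lambda>a. f (i * n + a)))"
    by (rule L2_set_le_sum) simp
  finally show ?thesis .
qed

lemma cnorm_block_le:
  assumes "i < p"
  shows "cnorm n (\<lambda>a. f (i * n + a)) \<le> cnorm (p * n) f"
proof -
  have eq: "(cnorm (p * n) f)\<^sup>2 = (\<Sum>i<p. (cnorm n (\<lambda>a. f (i * n + a)))\<^sup>2)"
    by (simp add: cnorm_def L2_set_def sum_nonneg sum_blocks)
  have "(cnorm n (\<lambda>a. f (i * n + a)))\<^sup>2 \<le> (cnorm (p * n) f)\<^sup>2"
    unfolding eq by (rule member_le_sum) (use assms in auto)
  then show ?thesis by (rule power2_le_imp_le) simp
qed

section \<open>The spectral norm as an operator norm\<close>

lemma mult_mat_vec_index: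
  "i < dim_row A \<Longrightarrow> v \<in> carrier_vec (dim_col A) \<Longrightarrow> (A *\<^sub>v v) $ i = (\<Sum>j<dim_col A. A $$ (i, j) * v $ j)"
  by (auto simp: scalar_prod_def lessThan_atLeast0)

lemma vec_norm2_mult:
  "v \<in> carrier_vec (dim_col A) \<Longrightarrow>
    vec_norm2 (A *\<^sub>v v) = cnorm (dim_row A) (\<lambda>i. \<Sum>j<dim_col A. A $$ (i, j) * v $ j)"
  unfolding vec_norm2_eq_cnorm by (auto intro!: cnorm_cong simp: mult_mat_vec_index simp del: index_mult_mat_vec)

text \<open>Values of \<open>f\<close> beyond the column range never enter, so arbitrary functions
  can replace carrier vectors.\<close>

lemma mat_norm2_alt:
  "mat_norm2 A = Sup {cnorm (dim_row A) (\<lambda>i. \<Sum>j<dim_col A. A $$ (i, j) * f j) | f. cnorm (dim_col A) f \<le> 1}"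
proof -
  have "{vec_norm2 (A *\<^sub>v v) | v. v \<in> carrier_vec (dim_col A) \<and> vec_norm2 v \<le> 1} =
    {cnorm (dim_row A) (\<lambda>i. \<Sum>j<dim_col A. A $$ (i, j) * f j) | f. cnorm (dim_col A) f \<le> 1}" (is "?X = ?Y")
  proof (intro equalityI subsetI)
    fix t assume "t \<in> ?X"
    then obtain v where v: "v \<in> carrier_vec (dim_col A)" "vec_norm2 v \<le> 1" "t = vec_norm2 (A *\<^sub>v v)" by auto
    then show "t \<in> ?Y" using vec_norm2_mult[OF v(1)]
      by (intro CollectI exI[of _ "\<lambda>i. v $ i"]) (auto simp: vec_norm2_eq_cnorm)
  next
    fix t assume "t \<in> ?Y"
    then obtain f where f: "cnorm (dim_col A) f \<le> 1"
      "t = cnorm (dim_row A) (\<lambda>i. \<Sum>j<dim_col A. A $$ (i, j) * f j)" by auto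
    have v: "vec (dim_col A) f \<in> carrier_vec (dim_col A)" by simp
    have "vec_norm2 (vec (dim_col A) f) = cnorm (dim_col A) f"
      unfolding vec_norm2_eq_cnorm by (auto intro!: cnorm_cong)
    moreover have "t = vec_norm2 (A *\<^sub>v vec (dim_col A) f)"
      unfolding vec_norm2_mult[OF v] f by (auto intro!: cnorm_cong sum.cong)
    ultimately show "t \<in> ?X" using f v by auto
  qed
  then show ?thesis by (simp add: mat_norm2_def)
qed

text \<open>\<open>Sup\<close> is informative only for a bounded set of reals. The entries of a
  vector of norm at most 1 have modulus at most 1, so the sum of the column norms is a
  bound.\<close>

lemma mat_norm2_bdd_above:
  "bdd_above {cnorm (dim_row A) (\<lambda>i. \<Sum>j<dim_col A. A $$ (i, j) * f j) | f. cnorm (dim_col A) f \<le> 1}"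
proof (rule bdd_aboveI)
  fix t assume "t \<in> {cnorm (dim_row A) (\<lambda>i. \<Sum>j<dim_col A. A $$ (i, j) * f j) | f. cnorm (dim_col A) f \<le> 1}"
  then obtain f where f: "cnorm (dim_col A) f \<le> 1"
    "t = cnorm (dim_row A) (\<lambda>i. \<Sum>j<dim_col A. A $$ (i, j) * f j)" by auto
  have "t \<le> (\<Sum>j<dim_col A. cnorm (dim_row A) (\<lambda>i. A $$ (i, j) * f j))"
    unfolding f by (rule cnorm_sum) simp
  also have "\<dots> = (\<Sum>j<dim_col A. cmod (f j) * cnorm (dim_row A) (\<lambda>i. A $$ (i, j)))"
    by (subst mult.commute) (simp add: cnorm_scale)
  also have "\<dots> \<le> (\<Sum>j<dim_col A. 1 * cnorm (dim_row A) (\<lambda>i. A $$ (i, j)))"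
    by (intro sum_mono mult_right_mono) (use f cnorm_ge_entry order_trans in \<open>auto, blast\<close>)
  finally show "t \<le> (\<Sum>j<dim_col A. 1 * cnorm (dim_row A) (\<lambda>i. A $$ (i, j)))" .
qed

lemma mat_norm2_upper:
  "cnorm (dim_row A) (\<lambda>i. \<Sum>j<dim_col A. A $$ (i, j) * f j) \<le> mat_norm2 A * cnorm (dim_col A) f"
proof (cases "cnorm (dim_col A) f = 0")
  case True
  then have "cnorm (dim_row A) (\<lambda>i. \<Sum>j<dim_col A. A $$ (i, j) * f j) = 0"
    by (simp add: cnorm_eq_0_iff)
  then show ?thesis using True by simp
next
  case False
  define c where "c = cnorm (dim_col A) f"
  have c: "c > 0" using False cnorm_nonneg[of "dim_col A" f] unfolding c_def by linarith
  define g where "g j = complex_of_real (1 / c) * f j" for j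
  have g: "cnorm (dim_col A) g = 1"
    using c unfolding g_def cnorm_scale by (simp add: c_def[symmetric] norm_divide)
  have "cnorm (dim_row A) (\<lambda>i. \<Sum>j<dim_col A. A $$ (i, j) * g j) \<le> mat_norm2 A"
    unfolding mat_norm2_alt by (rule cSup_upper[OF _ mat_norm2_bdd_above]) (use g in auto)
  moreover have "(\<Sum>j<dim_col A. A $$ (i, j) * g j)
      = complex_of_real (1 / c) * (\<Sum>j<dim_col A. A $$ (i, j) * f j)" for i
    by (simp add: g_def sum_distrib_left mult_ac)
  ultimately have "cnorm (dim_row A) (\<lambda>i. \<Sum>j<dim_col A. A $$ (i, j) * f j) / c \<le> mat_norm2 A"
    using c by (simp only: cnorm_scale) (simp add: norm_divide)
  then show ?thesis using c by (simp add: c_def[symmetric] field_simps)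
qed

lemma mat_norm2_least:
  assumes "0 \<le> K"
    and "\<And>f. cnorm (dim_row A) (\<lambda>i. \<Sum>j<dim_col A. A $$ (i, j) * f j) \<le> K * cnorm (dim_col A) f"
  shows "mat_norm2 A \<le> K"
  unfolding mat_norm2_alt
proof (rule cSup_least)
  have "cnorm (dim_col A) (\<lambda>i. 0) \<le> 1" by simp
  then show "{cnorm (dim_row A) (\<lambda>i. \<Sum>j<dim_col A. A $$ (i, j) * f j) | f. cnorm (dim_col A) f \<le> 1} \<noteq> {}"
    by blast
next
  fix t assume "t \<in> {cnorm (dim_row A) (\<lambda>i. \<Sum>j<dim_col A. A $$ (i, j) * f j) | f. cnorm (dim_col A) f \<le> 1}"
  then obtain f where f: "cnorm (dim_col A) f \<le> 1"
    "t = cnorm (dim_row A) (\<lambda>i. \<Sum>j<dim_col A. A $$ (i, j) * f j)" by auto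
  have "t \<le> K * cnorm (dim_col A) f" unfolding f by (rule assms)
  also have "\<dots> \<le> K * 1" using f assms by (intro mult_left_mono) auto
  finally show "t \<le> K" by simp
qed

lemma mat_norm2_nonneg: "0 \<le> mat_norm2 A"
proof -
  have "cnorm (dim_row A) (\<lambda>i. \<Sum>j<dim_col A. A $$ (i, j) * 0) \<le> mat_norm2 A"
    unfolding mat_norm2_alt by (rule cSup_upper[OF _ mat_norm2_bdd_above]) (auto intro!: exI[of _ "\<lambda>_. 0"])
  then show ?thesis by simp
qed

lemma mat_norm2_ge_entry:
  assumes "i < dim_row A" "j < dim_col A"
  shows "cmod (A $$ (i, j)) \<le> mat_norm2 A"
proof -
  let ?e = "\<lambda>k. if k = j then 1 else 0 :: complex"
  have e: "cnorm (dim_col A) ?e = 1"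
    using assms by (simp add: cnorm_def L2_set_def if_distrib[of cmod] if_distrib[of "\<lambda>t. t\<^sup>2"] sum.delta cong: if_cong)
  have "cmod (\<Sum>k<dim_col A. A $$ (i, k) * ?e k)
      \<le> cnorm (dim_row A) (\<lambda>i. \<Sum>k<dim_col A. A $$ (i, k) * ?e k)"
    by (rule cnorm_ge_entry[OF assms(1)])
  also have "\<dots> \<le> mat_norm2 A" using mat_norm2_upper[of A ?e] e by simp
  finally show ?thesis using assms(2) by (simp add: if_distrib sum.delta cong: if_cong)
qed

text \<open>Covers every scalar block that occurs: zero and identity blocks of \<open>M\<close>, and
  all blocks in the coefficients of the Kronecker products with \<open>L_mat\<close>.\<close>

lemma mat_norm2_scalar_mat:
  assumes "cmod s \<le> 1"
  shows "mat_norm2 (mat n n (\<lambda>(a, b). if a = b then s else 0)) \<le> 1"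
proof (rule mat_norm2_least)
  let ?A = "mat n n (\<lambda>(a, b). if a = b then s else 0)"
  fix f
  have "cnorm n (\<lambda>i. \<Sum>j<n. ?A $$ (i, j) * f j) = cnorm n (\<lambda>i. s * f i)"
    by (rule cnorm_cong) (simp add: sum.delta' if_distrib[of "\<lambda>t. t * _"] cong: if_cong)
  also have "\<dots> \<le> 1 * cnorm n f" unfolding cnorm_scale using assms by (intro mult_right_mono) auto
  finally show "cnorm (dim_row ?A) (\<lambda>i. \<Sum>j<dim_col ?A. ?A $$ (i, j) * f j) \<le> 1 * cnorm (dim_col ?A) f"
    by simp
qed simp

text \<open>\<open>\<parallel>A\<^sup>T f\<parallel>\<^sup>2\<close> is the bilinear pairing of \<open>f\<close> with \<open>A g\<close>, where \<open>g\<close> is the conjugate of \<open>A\<^sup>T f\<close>.\<close>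

lemma mat_norm2_transpose: "mat_norm2 (transpose_mat A) \<le> mat_norm2 A"
proof (rule mat_norm2_least[OF mat_norm2_nonneg])
  fix f
  define h where "h j = (\<Sum>i<dim_row A. A $$ (i, j) * f i)" for j
  define N where "N = cnorm (dim_col A) h"
  have "complex_of_real (N\<^sup>2) = (\<Sum>j<dim_col A. h j * cnj (h j))"
    by (simp add: N_def cnorm_def L2_set_def sum_nonneg complex_norm_square del: of_real_power)
  also have "\<dots> = (\<Sum>j<dim_col A. \<Sum>i<dim_row A. f i * (A $$ (i, j) * cnj (h j)))"
    by (simp add: h_def sum_distrib_right mult_ac)
  also have "\<dots> = (\<Sum>i<dim_row A. f i * (\<Sum>j<dim_col A. A $$ (i, j) * cnj (h j)))"
    by (subst sum.swap) (simp add: sum_distrib_left)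
  finally have "N\<^sup>2 = cmod (\<Sum>i<dim_row A. f i * (\<Sum>j<dim_col A. A $$ (i, j) * cnj (h j)))"
    by (metis norm_of_real abs_power2 power2_abs abs_of_nonneg zero_le_power2)
  also have "\<dots> \<le> cnorm (dim_row A) f * cnorm (dim_row A) (\<lambda>i. \<Sum>j<dim_col A. A $$ (i, j) * cnj (h j))"
    by (rule cmod_dot_le)
  also have "\<dots> \<le> cnorm (dim_row A) f * (mat_norm2 A * cnorm (dim_col A) (\<lambda>j. cnj (h j)))"
    by (intro mult_left_mono mat_norm2_upper) simp
  also have "\<dots> = mat_norm2 A * cnorm (dim_row A) f * N"
    by (simp add: cnorm_cnj N_def)
  finally have "N * N \<le> mat_norm2 A * cnorm (dim_row A) f * N" by (simp add: power2_eq_square)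
  moreover have "0 \<le> mat_norm2 A * cnorm (dim_row A) f" by (simp add: mat_norm2_nonneg)
  moreover have "0 \<le> N" by (simp add: N_def)
  ultimately have *: "N \<le> mat_norm2 A * cnorm (dim_row A) f"
    by (cases "N = 0") (auto simp: mult_le_cancel_right)
  have "cnorm (dim_col A) (\<lambda>i. \<Sum>j<dim_row A. transpose_mat A $$ (i, j) * f j) = N"
    unfolding N_def h_def by (rule cnorm_cong) simp
  with * show "cnorm (dim_row (transpose_mat A)) (\<lambda>i. \<Sum>j<dim_col (transpose_mat A). transpose_mat A $$ (i, j) * f j)
    \<le> mat_norm2 A * cnorm (dim_col (transpose_mat A)) f" by simp
qed

text \<open>A cruder but dimension-free bound suffices here, since the number of blocks depends on \<open>d\<close> only.\<close>

lemma mat_norm2_blocks: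
  assumes A: "A \<in> carrier_mat (p * n) (q * n)" and K: "0 \<le> K"
    and blocks: "\<And>i j. i < p \<Longrightarrow> j < q \<Longrightarrow> mat_norm2 (mat_block n A i j) \<le> K"
  shows "mat_norm2 A \<le> real p * real q * K"
proof (rule mat_norm2_least)
  show "0 \<le> real p * real q * K" using K by simp
next
  fix f
  have row: "cnorm n (\<lambda>a. \<Sum>k<q * n. A $$ (i * n + a, k) * f k) \<le> q * (K * cnorm (q * n) f)" if i: "i < p" for i
  proof -
    have "cnorm n (\<lambda>a. \<Sum>k<q * n. A $$ (i * n + a, k) * f k)
      = cnorm n (\<lambda>a. \<Sum>j<q. \<Sum>b<n. mat_block n A i j $$ (a, b) * f (j * n + b))"
      by (rule cnorm_cong) (simp add: sum_blocks mat_block_def)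
    also have "\<dots> \<le> (\<Sum>j<q. cnorm n (\<lambda>a. \<Sum>b<n. mat_block n A i j $$ (a, b) * f (j * n + b)))"
      by (rule cnorm_sum) simp
    also have "\<dots> \<le> (\<Sum>j<q. K * cnorm (q * n) f)"
    proof (rule sum_mono)
      fix j assume "j \<in> {..<q}"
      then have j: "j < q" by simp
      have "cnorm n (\<lambda>a. \<Sum>b<n. mat_block n A i j $$ (a, b) * f (j * n + b))
        \<le> mat_norm2 (mat_block n A i j) * cnorm n (\<lambda>b. f (j * n + b))"
        using mat_norm2_upper[of "mat_block n A i j" "\<lambda>b. f (j * n + b)"] by (simp add: mat_block_def)
      also have "\<dots> \<le> K * cnorm (q * n) f"
        by (intro mult_mono blocks i j K cnorm_block_le) auto
      finally show "cnorm n (\<lambda>a. \<Sum>b<n. mat_block n A i j $$ (a, b) * f (j * n + b)) \<le> K * cnorm (q * n) f" .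
    qed
    finally show ?thesis by simp
  qed
  have "cnorm (p * n) (\<lambda>i. \<Sum>k<q * n. A $$ (i, k) * f k) \<le> (\<Sum>i<p. q * (K * cnorm (q * n) f))"
    by (rule order_trans[OF cnorm_blocks_le]) (intro sum_mono row, simp)
  then show "cnorm (dim_row A) (\<lambda>i. \<Sum>j<dim_col A. A $$ (i, j) * f j) \<le> real p * real q * K * cnorm (dim_col A) f"
    using A by (simp add: mult_ac)
qed

subsection \<open>Simple eigenvalues\<close>

text \<open>A product in the Leibniz expansion either contains the corner \<open>(k, m)\<close>, or
  it contains two different factors divisible by \<open>c\<close>: one from row \<open>k\<close> and
  one from column \<open>m\<close>.\<close>

lemma square_dvd_det:
  fixes B :: "'a :: comm_ring_1 mat"
  assumes B: "B \<in> carrier_mat n n" and k: "k < n" and m: "m < n"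
    and corner: "c\<^sup>2 dvd B $$ (k, m)"
    and row: "\<And>i. i < n \<Longrightarrow> i \<noteq> m \<Longrightarrow> c dvd B $$ (k, i)"
    and col: "\<And>j. j < n \<Longrightarrow> j \<noteq> k \<Longrightarrow> c dvd B $$ (j, m)"
  shows "c\<^sup>2 dvd det B"
  unfolding det_def'[OF B]
proof (intro dvd_sum dvd_mult)
  fix p assume "p \<in> {p. p permutes {0..<n}}"
  then have p: "p permutes {0..<n}" by simp
  show "c\<^sup>2 dvd (\<Prod>i = 0..<n. B $$ (i, p i))"
  proof (cases "p k = m")
    case True
    have "B $$ (k, p k) dvd (\<Prod>i = 0..<n. B $$ (i, p i))"
      by (rule dvd_prodI) (use k in auto)
    with corner True show ?thesis by (auto intro: dvd_trans)
  next
    case False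
    obtain j where j: "p j = m" "j < n"
      using permutes_surj[OF p] p m by (metis atLeastLessThan_iff permutes_in_image surjD zero_le)
    have jk: "j \<noteq> k" using False j by auto
    have pk: "p k < n" using permutes_in_image[OF p] k by auto
    have "c\<^sup>2 dvd B $$ (k, p k) * B $$ (j, p j)"
      unfolding power2_eq_square using row[OF pk False] col[OF j(2) jk] j by (auto intro: mult_dvd_mono)
    also have "\<dots> = (\<Prod>i\<in>{k, j}. B $$ (i, p i))" using jk by simp
    also have "\<dots> dvd (\<Prod>i = 0..<n. B $$ (i, p i))"
      by (rule prod_dvd_prod_subset) (use k j in auto)
    finally show ?thesis .
  qed
qed

lemma pderiv_sum: "pderiv (sum f A) = (\<Sum>a\<in>A. pderiv (f a))"
  using higher_pderiv_sum[of 1 f A] by simp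

lemma square_dvd_of_double_root:
  fixes F :: "complex poly"
  assumes "poly F x = 0" "poly (pderiv F) x = 0"
  shows "[:- x, 1:]\<^sup>2 dvd F"
proof -
  obtain G where G: "F = [:- x, 1:] * G" using assms(1) by (auto simp: poly_eq_0_iff_dvd elim: dvdE)
  have "poly (pderiv F) x = poly G x" unfolding G pderiv_mult by (simp add: pderiv_pCons)
  then obtain H where "G = [:- x, 1:] * H" using assms(2) by (auto simp: poly_eq_0_iff_dvd elim: dvdE)
  with G have "F = [:- x, 1:]\<^sup>2 * H" by (simp only: power2_eq_square mult.assoc)
  then show ?thesis by (rule dvdI)
qed

text \<open>Replace a column of \<open>P\<close> by \<open>P v\<close>, then a row by \<open>u\<^sup>T\<close> times the result. By Cramer's rule the
  determinant only gains a nonzero constant factor; the new row and column vanish at \<open>x\<close>, and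
  their common entry is \<open>u\<^sup>T P v\<close>.\<close>

lemma simple_eigenvalue_pairing_nonzero:
  fixes P :: "complex poly mat" and u v :: "nat \<Rightarrow> complex"
  assumes P: "P \<in> carrier_mat n n" and simple: "simple_mpoly_eigenvalue P x"
    and v: "\<And>i. i < n \<Longrightarrow> (\<Sum>j<n. poly (P $$ (i, j)) x * v j) = 0"
    and u: "\<And>j. j < n \<Longrightarrow> (\<Sum>i<n. poly (P $$ (i, j)) x * u i) = 0"
    and k: "k < n" "v k \<noteq> 0" and m: "m < n" "u m \<noteq> 0"
  shows "(\<Sum>i<n. \<Sum>j<n. u i * poly (pderiv (P $$ (i, j))) x * v j) \<noteq> 0"
proof
  assume *: "(\<Sum>i<n. \<Sum>j<n. u i * poly (pderiv (P $$ (i, j))) x * v j) = 0"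
  define V where "V = vec n (\<lambda>j. [:v j:])"
  define U where "U = vec n (\<lambda>i. [:u i:])"
  define Q where "Q = replace_col P (P *\<^sub>v V) k"
  have V: "V \<in> carrier_vec n" and U: "U \<in> carrier_vec n" by (auto simp: V_def U_def)
  have Q: "Q \<in> carrier_mat n n" using P by (simp add: Q_def replace_col_def)
  then have Qt: "transpose_mat Q \<in> carrier_mat n n" by simp
  \<comment> \<open>The row replacement is carried out as a column replacement in the transpose.
    Hence the indices of \<open>B\<close> are swapped against those of \<open>P\<close>, and the
    common entry of the new row and column sits at \<open>(k, m)\<close>.\<close>
  define B where "B = replace_col (transpose_mat Q) (transpose_mat Q *\<^sub>v U) m"
  have B: "B \<in> carrier_mat n n" using Q by (simp add: B_def replace_col_def)
  have "det B = U $ m * det (transpose_mat Q)"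
    unfolding B_def by (rule cramer_lemma_mat[OF Qt U m(1)])
  also have "\<dots> = U $ m * (V $ k * det P)"
    using cramer_lemma_mat[OF P V k(1)] by (simp add: det_transpose[OF Q] Q_def[symmetric])
  finally have detB: "det B = smult (u m * v k) (det P)"
    using m k by (simp add: U_def V_def mult.commute)
  have Qij: "Q $$ (i, j) = (if j = k then \<Sum>j'<n. P $$ (i, j') * [:v j':] else P $$ (i, j))"
    if "i < n" "j < n" for i j
    using that P by (auto simp: Q_def replace_col_def V_def scalar_prod_def lessThan_atLeast0)
  have Bji: "B $$ (j, i) = (if i = m then \<Sum>i'<n. Q $$ (i', j) * [:u i':] else Q $$ (i, j))"
    if "i < n" "j < n" for i j
    using that Q by (auto simp: B_def replace_col_def U_def scalar_prod_def lessThan_atLeast0)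
  have "[:- x, 1:]\<^sup>2 dvd det B"
  proof (rule square_dvd_det[OF B k(1) m(1)])
    fix i assume i: "i < n" "i \<noteq> m"
    have "poly (B $$ (k, i)) x = 0"
      using v[OF i(1)] i k by (simp add: Bji Qij poly_sum mult.commute)
    then show "[:- x, 1:] dvd B $$ (k, i)" by (simp add: poly_eq_0_iff_dvd)
  next
    fix j assume j: "j < n" "j \<noteq> k"
    have "poly (B $$ (j, m)) x = 0"
      using u[OF j(1)] j m by (simp add: Bji Qij poly_sum mult.commute)
    then show "[:- x, 1:] dvd B $$ (j, m)" by (simp add: poly_eq_0_iff_dvd)
  next
    have Bkm: "B $$ (k, m) = (\<Sum>i<n. \<Sum>j<n. [:u i:] * (P $$ (i, j) * [:v j:]))"
      using k m by (simp add: Bji Qij sum_distrib_left mult.commute del: mult_pCons_left mult_pCons_right)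
    have "poly (B $$ (k, m)) x = (\<Sum>i<n. u i * (\<Sum>j<n. poly (P $$ (i, j)) x * v j))"
      unfolding Bkm by (simp add: poly_sum sum_distrib_left mult_ac)
    then have 0: "poly (B $$ (k, m)) x = 0" using v by simp
    \<comment> \<open>The vectors are constant, so the derivative of the corner is exactly the
      pairing assumed to vanish.\<close>
    have "poly (pderiv (B $$ (k, m))) x = 0"
      unfolding Bkm using * by (simp add: pderiv_sum pderiv_smult poly_sum mult_ac)
    with 0 show "[:- x, 1:]\<^sup>2 dvd B $$ (k, m)" by (rule square_dvd_of_double_root)
  qed
  then have "[:- x, 1:]\<^sup>2 dvd det P"
    unfolding detB using k m by (simp add: dvd_smult_cancel dvd_smult_iff)
  then have "2 \<le> order x (det P)"
    using simple by (simp add: simple_mpoly_eigenvalue_def mpoly_regular_def order_divides)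
  then show False using simple by (simp add: simple_mpoly_eigenvalue_def)
qed

text \<open>Two kernel vectors always admit a combination whose pairing with \<open>u\<close> vanishes.\<close>

lemma simple_eigenvalue_kernel_line:
  fixes P :: "complex poly mat" and u v w :: "nat \<Rightarrow> complex"
  assumes P: "P \<in> carrier_mat n n" and simple: "simple_mpoly_eigenvalue P x"
    and v: "\<And>i. i < n \<Longrightarrow> (\<Sum>j<n. poly (P $$ (i, j)) x * v j) = 0"
    and w: "\<And>i. i < n \<Longrightarrow> (\<Sum>j<n. poly (P $$ (i, j)) x * w j) = 0"
    and u: "\<And>j. j < n \<Longrightarrow> (\<Sum>i<n. poly (P $$ (i, j)) x * u i) = 0"
    and k: "k < n" "v k \<noteq> 0" and m: "m < n" "u m \<noteq> 0"
  obtains c where "\<And>i. i < n \<Longrightarrow> w i = c * v i"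
proof -
  define D where "D f = (\<Sum>i<n. \<Sum>j<n. u i * poly (pderiv (P $$ (i, j))) x * f j)" for f :: "nat \<Rightarrow> complex"
  have Dv: "D v \<noteq> 0" unfolding D_def by (rule simple_eigenvalue_pairing_nonzero[OF P simple v u k m])
  define c where "c = D w / D v"
  have "w i = c * v i" if i: "i < n" for i
  proof (rule ccontr)
    assume ne: "w i \<noteq> c * v i"
    have "D (\<lambda>j. w j - c * v j) = D w - c * D v"
      by (simp add: D_def sum_subtractf sum_distrib_left algebra_simps)
    also have "\<dots> = 0" using Dv by (simp add: c_def)
    finally have "D (\<lambda>j. w j - c * v j) = 0" .
    moreover have "D (\<lambda>j. w j - c * v j) \<noteq> 0"
      unfolding D_def
    proof (rule simple_eigenvalue_pairing_nonzero[OF P simple _ u i _ m])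
      fix i assume i: "i < n"
      have "(\<Sum>j<n. poly (P $$ (i, j)) x * (w j - c * v j))
        = (\<Sum>j<n. poly (P $$ (i, j)) x * w j) - c * (\<Sum>j<n. poly (P $$ (i, j)) x * v j)"
        by (simp add: sum_subtractf sum_distrib_left algebra_simps)
      then show "(\<Sum>j<n. poly (P $$ (i, j)) x * (w j - c * v j)) = 0" using v[OF i] w[OF i] by simp
    qed (use ne in auto)
    ultimately show False by simp
  qed
  then show thesis by (rule that)
qed

subsection \<open>Block Kronecker forms and their null vectors\<close>

lemma block_index_less:
  fixes i p a n :: nat
  assumes "i < p" "a < n"
  shows "i * n + a < p * n"
proof -
  have "i * n + a < (i + 1) * n" using assms by simp
  also have "\<dots> \<le> p * n" using assms by (intro mult_right_mono) auto
  finally show ?thesis .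
qed

text \<open>Row \<open>i\<close> of the transposed \<open>L_mat k q\<close>, applied to
  \<open>h\<close>. The case distinctions are the two ends of the band: row \<open>k\<close> has no
  entry \<open>- 1\<close>, row 0 has no entry \<open>q\<close>.\<close>

lemma bidiagonal_row_sum:
  fixes q :: "'a :: comm_ring_1"
  assumes "i \<le> k"
  shows "(\<Sum>j<k. (if i = j then - 1 else if i = Suc j then q else 0) * h j)
    = (if i < k then - h i else 0) + (if 0 < i then q * h (i - 1) else 0)"
proof -
  have "(\<Sum>j<k. (if i = j then - 1 else if i = Suc j then q else 0) * h j)
    = (\<Sum>j<k. (if j = i then - h i else 0) + (if 0 < i \<and> j = i - 1 then q * h (i - 1) else 0))"
    by (rule sum.cong) auto
  also have "\<dots> = (if i < k then - h i else 0) + (if 0 < i then q * h (i - 1) else 0)"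
    using assms by (cases i) (auto simp: sum.distrib sum.delta)
  finally show ?thesis .
qed

text \<open>This is Lambda_k(q)^T L_k(q)^T = 0 applied to an arbitrary \<open>h\<close>: column
  \<open>j\<close> only meets the two terms - q^(k-j) and q^(k-j-1) q, which cancel.\<close>

lemma bidiagonal_telescope:
  fixes q :: "'a :: comm_ring_1"
  shows "(\<Sum>i<Suc k. q ^ (k - i) * (\<Sum>j<k. (if i = j then - 1 else if i = Suc j then q else 0) * h j)) = 0"
proof -
  have "(\<Sum>i<Suc k. q ^ (k - i) * (\<Sum>j<k. (if i = j then - 1 else if i = Suc j then q else 0) * h j))
    = (\<Sum>j<k. \<Sum>i<Suc k. q ^ (k - i) * ((if i = j then - 1 else if i = Suc j then q else 0) * h j))"
    unfolding sum_distrib_left by (rule sum.swap)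
  also have "\<dots> = (\<Sum>j<k. \<Sum>i<Suc k. (if i = j then - (q ^ (k - j) * h j) else 0)
      + (if i = Suc j then q ^ (k - Suc j) * q * h j else 0))"
    by (intro sum.cong) auto
  also have "\<dots> = (\<Sum>j<k. - (q ^ (k - j) * h j) + q ^ (k - Suc j) * q * h j)"
    by (intro sum.cong refl) (auto simp: sum.distrib sum.delta simp del: sum.lessThan_Suc)
  also have "\<dots> = 0"
    by (rule sum.neutral) (auto simp flip: power_Suc2 simp: Suc_diff_Suc)
  finally show ?thesis .
qed

lemma poly_eq_sum_upto:
  fixes p :: "'a :: comm_semiring_1 poly"
  assumes "\<And>t. l < t \<Longrightarrow> coeff p t = 0"
  shows "poly p x = (\<Sum>t\<le>l. coeff p t * x ^ t)"
proof -
  have "degree p \<le> l" using assms by (rule degree_le[rule_format])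
  then show ?thesis unfolding poly_altdef
    by (intro sum.mono_neutral_left) (auto simp: coeff_eq_0)
qed

lemma power_le_max_1:
  fixes r :: real
  assumes "0 \<le> r" "t \<le> l"
  shows "r ^ t \<le> max 1 (r ^ l)"
proof (cases "r \<le> 1")
  case True
  then show ?thesis using assms by (simp add: power_le_one le_max_iff_disj)
next
  case False
  then show ?thesis using assms power_increasing[of t l r] by (simp add: le_max_iff_disj)
qed

text \<open>The entrywise form of the block Kronecker structure: \<open>m i a j b\<close> is the entry \<open>(a, b)\<close> of the
  block \<open>(i, j)\<close> of \<open>M\<close>. Every property is preserved by transposition with \<open>\<epsilon>\<close> and \<open>\<eta>\<close> exchanged,
  so left eigenvectors are right eigenvectors of an instance of the same locale.\<close>

locale block_kronecker_form =
  fixes n l \<epsilon> \<eta> :: nat and P Q :: "complex poly mat" and m :: "nat \<Rightarrow> nat \<Rightarrow> nat \<Rightarrow> nat \<Rightarrow> complex poly"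
  assumes P_carrier: "P \<in> carrier_mat n n"
    and Q_carrier: "Q \<in> carrier_mat ((\<epsilon> + \<eta> + 1) * n) ((\<epsilon> + \<eta> + 1) * n)"
    and P_entry: "\<And>a b. a < n \<Longrightarrow> b < n \<Longrightarrow>
      P $$ (a, b) = (\<Sum>i<Suc \<eta>. \<Sum>j<Suc \<epsilon>. monom 1 l ^ (\<eta> - i) * m i a j b * monom 1 l ^ (\<epsilon> - j))"
    and Q_11: "\<And>i j a b. i < Suc \<eta> \<Longrightarrow> j < Suc \<epsilon> \<Longrightarrow> a < n \<Longrightarrow> b < n \<Longrightarrow>
      Q $$ (i * n + a, j * n + b) = m i a j b"
    and Q_12: "\<And>i j a b. i < Suc \<eta> \<Longrightarrow> j < \<eta> \<Longrightarrow> a < n \<Longrightarrow> b < n \<Longrightarrow>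
      Q $$ (i * n + a, (Suc \<epsilon> + j) * n + b) =
        (if a = b then if i = j then - 1 else if i = Suc j then monom 1 l else 0 else 0)"
    and Q_21: "\<And>i j a b. i < \<epsilon> \<Longrightarrow> j < Suc \<epsilon> \<Longrightarrow> a < n \<Longrightarrow> b < n \<Longrightarrow>
      Q $$ ((Suc \<eta> + i) * n + a, j * n + b) =
        (if a = b then if j = i then - 1 else if j = Suc i then monom 1 l else 0 else 0)"
    and Q_22: "\<And>i j a b. i < \<epsilon> \<Longrightarrow> j < \<eta> \<Longrightarrow> a < n \<Longrightarrow> b < n \<Longrightarrow>
      Q $$ ((Suc \<eta> + i) * n + a, (Suc \<epsilon> + j) * n + b) = 0"
    and m_degree: "\<And>i j a b t. i < Suc \<eta> \<Longrightarrow> j < Suc \<epsilon> \<Longrightarrow> a < n \<Longrightarrow> b < n \<Longrightarrow> l < t \<Longrightarrow>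
      coeff (m i a j b) t = 0"
    and m_norm: "\<And>i j t. i < Suc \<eta> \<Longrightarrow> j < Suc \<epsilon> \<Longrightarrow> t \<le> l \<Longrightarrow>
      mat_norm2 (mat n n (\<lambda>(a, b). coeff (m i a j b) t)) \<le> 1"
begin

abbreviation "N \<equiv> (\<epsilon> + \<eta> + 1) * n"

lemma transposed: "block_kronecker_form n l \<eta> \<epsilon> (transpose_mat P) (transpose_mat Q) (\<lambda>i a j b. m j b i a)"
proof -
  have dim: "\<And>i a. i < Suc \<eta> \<Longrightarrow> a < n \<Longrightarrow> i * n + a < N" "\<And>i a. i < Suc \<epsilon> \<Longrightarrow> a < n \<Longrightarrow> i * n + a < N"
    "\<And>i a. i < \<epsilon> \<Longrightarrow> a < n \<Longrightarrow> (Suc \<eta> + i) * n + a < N" "\<And>i a. i < \<eta> \<Longrightarrow> a < n \<Longrightarrow> (Suc \<epsilon> + i) * n + a < N"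
    by (rule block_index_less; simp)+
  have Qd: "dim_row Q = N" "dim_col Q = N" using Q_carrier by auto
  have Qt: "\<And>k k'. k < N \<Longrightarrow> k' < N \<Longrightarrow> transpose_mat Q $$ (k, k') = Q $$ (k', k)" using Qd by simp
  show ?thesis
  proof
    show "transpose_mat P \<in> carrier_mat n n" using P_carrier by simp
    show "transpose_mat Q \<in> carrier_mat ((\<eta> + \<epsilon> + 1) * n) ((\<eta> + \<epsilon> + 1) * n)"
      using Q_carrier by (simp add: add.commute)
    fix a b assume ab: "a < n" "b < n"
    have "transpose_mat P $$ (a, b) = P $$ (b, a)" using ab P_carrier by simp
    also have "\<dots> = (\<Sum>j<Suc \<epsilon>. \<Sum>i<Suc \<eta>. monom 1 l ^ (\<eta> - i) * m i b j a * monom 1 l ^ (\<epsilon> - j))"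
      unfolding P_entry[OF ab(2,1)] by (rule sum.swap)
    also have "\<dots> = (\<Sum>j<Suc \<epsilon>. \<Sum>i<Suc \<eta>. monom 1 l ^ (\<epsilon> - j) * m i b j a * monom 1 l ^ (\<eta> - i))"
      by (intro sum.cong refl) (simp only: mult_ac)
    finally show "transpose_mat P $$ (a, b) = \<dots>" .
  next
    fix i j t assume ij: "i < Suc \<epsilon>" "j < Suc \<eta>" "t \<le> l"
    have eq: "mat n n (\<lambda>(a, b). coeff (m j b i a) t) = transpose_mat (mat n n (\<lambda>(a, b). coeff (m j a i b) t))"
      by (rule eq_matI) auto
    show "mat_norm2 (mat n n (\<lambda>(a, b). coeff (m j b i a) t)) \<le> 1"
      unfolding eq by (rule order_trans[OF mat_norm2_transpose m_norm[OF ij(2,1,3)]])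
  next
    fix i j a b assume h: "i < Suc \<epsilon>" "j < Suc \<eta>" "a < n" "b < n"
    show "transpose_mat Q $$ (i * n + a, j * n + b) = m j b i a"
      using h by (simp only: Qt dim Q_11)
  next
    fix i j a b assume h: "i < Suc \<epsilon>" "j < \<epsilon>" "a < n" "b < n"
    show "transpose_mat Q $$ (i * n + a, (Suc \<eta> + j) * n + b)
      = (if a = b then if i = j then - 1 else if i = Suc j then monom 1 l else 0 else 0)"
      using h by (simp only: Qt dim Q_21 eq_commute[of b a])
  next
    fix i j a b assume h: "i < \<eta>" "j < Suc \<eta>" "a < n" "b < n"
    show "transpose_mat Q $$ ((Suc \<epsilon> + i) * n + a, j * n + b)
      = (if a = b then if j = i then - 1 else if j = Suc i then monom 1 l else 0 else 0)"
      using h by (simp only: Qt dim Q_12 eq_commute[of b a])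
  next
    fix i j a b assume h: "i < \<eta>" "j < \<epsilon>" "a < n" "b < n"
    show "transpose_mat Q $$ ((Suc \<epsilon> + i) * n + a, (Suc \<eta> + j) * n + b) = 0"
      using h by (simp only: Qt dim Q_22)
  next
    fix i j a b t assume "i < Suc \<epsilon>" "j < Suc \<eta>" "a < n" "b < n" "l < t"
    then show "coeff (m j b i a) t = 0" by (intro m_degree)
  qed
qed

text \<open>Rows of \<open>Q\<close> split as (\<eta> + 1) + \<epsilon> blocks but columns as
  (\<epsilon> + 1) + \<eta>, so the same range needs two decompositions.\<close>

lemma sum_rows: "(\<Sum>k<N. f k) = (\<Sum>i<Suc \<eta>. \<Sum>a<n. f (i * n + a)) + (\<Sum>i<\<epsilon>. \<Sum>a<n. f ((Suc \<eta> + i) * n + a))"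
  for f :: "nat \<Rightarrow> 'a :: comm_monoid_add"
proof -
  have "N = (Suc \<eta> + \<epsilon>) * n" by simp
  then show ?thesis by (simp only: sum_blocks sum_lessThan_add)
qed

lemma sum_cols: "(\<Sum>k<N. f k) = (\<Sum>j<Suc \<epsilon>. \<Sum>b<n. f (j * n + b)) + (\<Sum>j<\<eta>. \<Sum>b<n. f ((Suc \<epsilon> + j) * n + b))"
  for f :: "nat \<Rightarrow> 'a :: comm_monoid_add"
proof -
  have "N = (Suc \<epsilon> + \<eta>) * n" by simp
  then show ?thesis by (simp only: sum_blocks sum_lessThan_add)
qed

text \<open>The vector \<open>Z\<close> has polynomial entries. Constant entries give the rows of
  Q(x) z after evaluation, while entries containing powers of \<open>monom 1 l\<close> give
  identities that can be differentiated.\<close>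

lemma top_row:
  assumes i: "i < Suc \<eta>" and a: "a < n"
  shows "(\<Sum>k<N. Q $$ (i * n + a, k) * Z k) = (\<Sum>j<Suc \<epsilon>. \<Sum>b<n. m i a j b * Z (j * n + b))
    + (\<Sum>j<\<eta>. (if i = j then - 1 else if i = Suc j then monom 1 l else 0) * Z ((Suc \<epsilon> + j) * n + a))"
proof -
  have "(\<Sum>j<\<eta>. \<Sum>b<n. Q $$ (i * n + a, (Suc \<epsilon> + j) * n + b) * Z ((Suc \<epsilon> + j) * n + b))
    = (\<Sum>j<\<eta>. \<Sum>b<n. if b = a then (if i = j then - 1 else if i = Suc j then monom 1 l else 0) * Z ((Suc \<epsilon> + j) * n + a) else 0)"
    by (intro sum.cong refl) (auto simp only: Q_12[OF i _ a] lessThan_iff mult_zero_left split: if_splits)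
  also have "\<dots> = (\<Sum>j<\<eta>. (if i = j then - 1 else if i = Suc j then monom 1 l else 0) * Z ((Suc \<epsilon> + j) * n + a))"
    using a by (simp only: sum.delta finite_lessThan lessThan_iff if_True)
  moreover have "(\<Sum>j<Suc \<epsilon>. \<Sum>b<n. Q $$ (i * n + a, j * n + b) * Z (j * n + b))
    = (\<Sum>j<Suc \<epsilon>. \<Sum>b<n. m i a j b * Z (j * n + b))"
    by (intro sum.cong refl) (simp only: Q_11[OF i _ a] lessThan_iff)
  ultimately show ?thesis unfolding sum_cols by presburger
qed

lemma bottom_row:
  assumes i: "i < \<epsilon>" and a: "a < n"
  shows "(\<Sum>k<N. Q $$ ((Suc \<eta> + i) * n + a, k) * Z k) = - Z (i * n + a) + monom 1 l * Z (Suc i * n + a)"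
proof -
  have "(\<Sum>j<\<eta>. \<Sum>b<n. Q $$ ((Suc \<eta> + i) * n + a, (Suc \<epsilon> + j) * n + b) * Z ((Suc \<epsilon> + j) * n + b)) = 0"
    by (intro sum.neutral ballI) (simp only: Q_22[OF i _ a] lessThan_iff mult_zero_left)
  moreover have "(\<Sum>j<Suc \<epsilon>. \<Sum>b<n. Q $$ ((Suc \<eta> + i) * n + a, j * n + b) * Z (j * n + b))
    = (\<Sum>j<Suc \<epsilon>. \<Sum>b<n. if b = a then (if j = i then - 1 else if j = Suc i then monom 1 l else 0) * Z (j * n + a) else 0)"
    by (intro sum.cong refl) (auto simp only: Q_21[OF i _ a] lessThan_iff mult_zero_left split: if_splits)
  moreover have "\<dots> = (\<Sum>j<Suc \<epsilon>. (if j = i then - 1 else if j = Suc i then monom 1 l else 0) * Z (j * n + a))"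
    using a by (simp only: sum.delta finite_lessThan lessThan_iff if_True)
  moreover have "\<dots> = (\<Sum>j<Suc \<epsilon>. (if j = i then - Z (i * n + a) else 0) + (if j = Suc i then monom 1 l * Z (Suc i * n + a) else 0))"
    by (rule sum.cong) auto
  moreover have "\<dots> = - Z (i * n + a) + monom 1 l * Z (Suc i * n + a)"
    using i by (simp add: sum.distrib sum.delta del: sum.lessThan_Suc)
  ultimately show ?thesis unfolding sum_cols by simp
qed

text \<open>The second block components of \<open>W\<close> and \<open>Z\<close> are arbitrary: they meet only the vanishing
  products of \<open>L_mat\<close> with \<open>Lambda_mat\<close>.\<close>

lemma bilinear_identity:
  assumes W: "\<And>i a. i < Suc \<eta> \<Longrightarrow> a < n \<Longrightarrow> W (i * n + a) = monom 1 l ^ (\<eta> - i) * u a"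
    and Z: "\<And>j b. j < Suc \<epsilon> \<Longrightarrow> b < n \<Longrightarrow> Z (j * n + b) = monom 1 l ^ (\<epsilon> - j) * v b"
  shows "(\<Sum>k<N. \<Sum>k'<N. W k * Q $$ (k, k') * Z k') = (\<Sum>a<n. \<Sum>b<n. u a * P $$ (a, b) * v b)"
proof -
  let ?q = "monom 1 l :: complex poly"
  let ?c = "\<lambda>i j. if i = j then - 1 else if i = Suc j then ?q else 0"
  have bottom: "(\<Sum>k<N. Q $$ ((Suc \<eta> + i) * n + a, k) * Z k) = 0" if "i < \<epsilon>" "a < n" for i a
  proof -
    have "?q ^ (\<epsilon> - i) = ?q * ?q ^ (\<epsilon> - Suc i)"
      using that by (simp flip: power_Suc add: Suc_diff_Suc)
    then show ?thesis
      using Z[of i a] Z[of "Suc i" a] that bottom_row[OF that] by (simp add: mult.assoc)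
  qed
  have bottom_sum: "(\<Sum>i<\<epsilon>. \<Sum>a<n. W ((Suc \<eta> + i) * n + a) * (\<Sum>k'<N. Q $$ ((Suc \<eta> + i) * n + a, k') * Z k')) = 0"
    by (intro sum.neutral ballI) (simp only: bottom lessThan_iff mult_zero_right)
  \<comment> \<open>Pulls \<open>u a\<close> out of the second summand, which leaves exactly the
    expression that \<open>bidiagonal_telescope\<close> annihilates.\<close>
  have split: "a * b * (s + t) = a * b * s + b * (a * t)" for a b s t :: "complex poly"
    by (simp only: distrib_left mult_ac)
  have "(\<Sum>k<N. \<Sum>k'<N. W k * Q $$ (k, k') * Z k') = (\<Sum>k<N. W k * (\<Sum>k'<N. Q $$ (k, k') * Z k'))"
    by (simp only: sum_distrib_left mult.assoc)
  also have "\<dots> = (\<Sum>i<Suc \<eta>. \<Sum>a<n. W (i * n + a) * (\<Sum>k'<N. Q $$ (i * n + a, k') * Z k'))"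
    unfolding sum_rows[of "\<lambda>k. W k * (\<Sum>k'<N. Q $$ (k, k') * Z k')"] bottom_sum by (rule add_0_right)
  also have "\<dots> = (\<Sum>i<Suc \<eta>. \<Sum>a<n. ?q ^ (\<eta> - i) * u a *
      ((\<Sum>j<Suc \<epsilon>. \<Sum>b<n. m i a j b * (?q ^ (\<epsilon> - j) * v b)) + (\<Sum>j<\<eta>. ?c i j * Z ((Suc \<epsilon> + j) * n + a))))"
  proof (intro sum.cong refl)
    fix i a assume "i \<in> {..<Suc \<eta>}" and "a \<in> {..<n}"
    then have i: "i < Suc \<eta>" and a: "a < n" by auto
    have M: "(\<Sum>j<Suc \<epsilon>. \<Sum>b<n. m i a j b * Z (j * n + b))
      = (\<Sum>j<Suc \<epsilon>. \<Sum>b<n. m i a j b * (?q ^ (\<epsilon> - j) * v b))"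
      by (intro sum.cong refl) (simp only: Z lessThan_iff)
    show "W (i * n + a) * (\<Sum>k'<N. Q $$ (i * n + a, k') * Z k') = ?q ^ (\<eta> - i) * u a *
      ((\<Sum>j<Suc \<epsilon>. \<Sum>b<n. m i a j b * (?q ^ (\<epsilon> - j) * v b)) + (\<Sum>j<\<eta>. ?c i j * Z ((Suc \<epsilon> + j) * n + a)))"
      unfolding top_row[OF i a] W[OF i a] M ..
  qed
  also have "\<dots> = (\<Sum>i<Suc \<eta>. \<Sum>a<n. ?q ^ (\<eta> - i) * u a * (\<Sum>j<Suc \<epsilon>. \<Sum>b<n. m i a j b * (?q ^ (\<epsilon> - j) * v b)))
    + (\<Sum>i<Suc \<eta>. \<Sum>a<n. u a * (?q ^ (\<eta> - i) * (\<Sum>j<\<eta>. ?c i j * Z ((Suc \<epsilon> + j) * n + a))))"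
    unfolding split sum.distrib ..
  also have "(\<Sum>i<Suc \<eta>. \<Sum>a<n. u a * (?q ^ (\<eta> - i) * (\<Sum>j<\<eta>. ?c i j * Z ((Suc \<epsilon> + j) * n + a))))
    = (\<Sum>a<n. u a * (\<Sum>i<Suc \<eta>. ?q ^ (\<eta> - i) * (\<Sum>j<\<eta>. ?c i j * Z ((Suc \<epsilon> + j) * n + a))))"
    by (subst sum.swap) (simp only: sum_distrib_left)
  also have "\<dots> = 0" by (simp only: bidiagonal_telescope mult_zero_right sum.neutral_const)
  also have "(\<Sum>i<Suc \<eta>. \<Sum>a<n. ?q ^ (\<eta> - i) * u a * (\<Sum>j<Suc \<epsilon>. \<Sum>b<n. m i a j b * (?q ^ (\<epsilon> - j) * v b)))
    = (\<Sum>i<Suc \<eta>. \<Sum>a<n. \<Sum>j<Suc \<epsilon>. \<Sum>b<n. u a * (?q ^ (\<eta> - i) * m i a j b * ?q ^ (\<epsilon> - j)) * v b)"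
    unfolding sum_distrib_left by (intro sum.cong refl) (simp only: mult_ac)
  also have "\<dots> = (\<Sum>a<n. \<Sum>i<Suc \<eta>. \<Sum>b<n. \<Sum>j<Suc \<epsilon>. u a * (?q ^ (\<eta> - i) * m i a j b * ?q ^ (\<epsilon> - j)) * v b)"
    by (subst sum.swap, rule sum.cong[OF refl], rule sum.cong[OF refl], rule sum.swap)
  also have "\<dots> = (\<Sum>a<n. \<Sum>b<n. \<Sum>i<Suc \<eta>. \<Sum>j<Suc \<epsilon>. u a * (?q ^ (\<eta> - i) * m i a j b * ?q ^ (\<epsilon> - j)) * v b)"
    by (rule sum.cong[OF refl], rule sum.swap)
  also have "\<dots> = (\<Sum>a<n. \<Sum>b<n. u a * P $$ (a, b) * v b)"
    by (intro sum.cong refl) (simp only: P_entry lessThan_iff sum_distrib_left sum_distrib_right)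
  finally show ?thesis by simp
qed

section \<open>Vectors in the kernel of Q(x)\<close>

context
  fixes x :: complex and z :: "nat \<Rightarrow> complex"
  assumes kernel: "\<And>k. k < N \<Longrightarrow> (\<Sum>k'<N. poly (Q $$ (k, k')) x * z k') = 0"
begin

text \<open>The lower block rows read z_i = x^l z_(i+1), so the first \<epsilon> + 1 blocks are all
  determined by the last of them, number \<epsilon>; the induction moves away from it.\<close>

lemma kernel_first_blocks:
  assumes "j < Suc \<epsilon>" "b < n"
  shows "z (j * n + b) = (x ^ l) ^ (\<epsilon> - j) * z (\<epsilon> * n + b)"
proof -
  have step: "z (i * n + b) = x ^ l * z (Suc i * n + b)" if i: "i < \<epsilon>" for i
  proof -
    have "poly (\<Sum>k<N. Q $$ ((Suc \<eta> + i) * n + b, k) * [:z k:]) x = 0"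
      unfolding poly_sum poly_mult
      using kernel[of "(Suc \<eta> + i) * n + b"] block_index_less[of "Suc \<eta> + i" "\<epsilon> + \<eta> + 1" b n] i assms by simp
    then show ?thesis
      unfolding bottom_row[OF i assms(2)] by (simp add: poly_monom mult.commute)
  qed
  have "t \<le> \<epsilon> \<Longrightarrow> z ((\<epsilon> - t) * n + b) = (x ^ l) ^ t * z (\<epsilon> * n + b)" for t
  proof (induction t)
    case (Suc t)
    then have "Suc (\<epsilon> - Suc t) = \<epsilon> - t" by simp
    then show ?case using step[of "\<epsilon> - Suc t"] Suc by simp
  qed simp
  from this[of "\<epsilon> - j"] show ?thesis using assms by simp
qed

text \<open>Row \<open>a\<close> of P(x) v arises by multiplying Q from the left with Lambda_\<eta>
  (x) e_a, extended by zero, and from the right with \<open>z\<close>; since Q(x) z = 0, it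
  vanishes.\<close>

lemma kernel_last_block:
  assumes "a < n"
  shows "(\<Sum>b<n. poly (P $$ (a, b)) x * z (\<epsilon> * n + b)) = 0"
proof -
  define W where "W k = (if k div n < Suc \<eta> then monom 1 l ^ (\<eta> - k div n) * (if k mod n = a then 1 else 0) else 0 :: complex poly)" for k
  \<comment> \<open>A polynomial vector with value \<open>z\<close> at \<open>x\<close>: powers of
    \<open>monom 1 l\<close> in the first \<epsilon> + 1 blocks, as \<open>bilinear_identity\<close>
    requires, and constants in the others.\<close>
  define Z where "Z k = (if k div n < Suc \<epsilon> then monom 1 l ^ (\<epsilon> - k div n) * [:z (\<epsilon> * n + k mod n):] else [:z k:])" for k
  have Zx: "poly (Z k) x = z k" if "k < N" for k
  proof (cases "k div n < Suc \<epsilon>")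
    case True
    have "k mod n < n" using assms by simp
    from kernel_first_blocks[OF True this] show ?thesis
      using True by (simp add: Z_def poly_monom poly_power del: power_mult)
  qed (simp add: Z_def)
  have "(\<Sum>k<N. \<Sum>k'<N. W k * Q $$ (k, k') * Z k')
    = (\<Sum>a'<n. \<Sum>b<n. (if a' = a then 1 else 0) * P $$ (a', b) * [:z (\<epsilon> * n + b):])"
    by (rule bilinear_identity) (simp_all add: W_def Z_def)
  also have "\<dots> = (\<Sum>a'<n. if a' = a then \<Sum>b<n. P $$ (a, b) * [:z (\<epsilon> * n + b):] else 0)"
    by (intro sum.cong) auto
  also have "\<dots> = (\<Sum>b<n. P $$ (a, b) * [:z (\<epsilon> * n + b):])"
    using assms by (simp only: sum.delta finite_lessThan lessThan_iff if_True)
  finally have "(\<Sum>b<n. poly (P $$ (a, b)) x * z (\<epsilon> * n + b))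
    = poly (\<Sum>k<N. \<Sum>k'<N. W k * Q $$ (k, k') * Z k') x"
    by (simp add: poly_sum mult.commute)
  also have "\<dots> = (\<Sum>k<N. poly (W k) x * (\<Sum>k'<N. poly (Q $$ (k, k')) x * z k'))"
    unfolding poly_sum poly_mult sum_distrib_left mult.assoc by (intro sum.cong refl) (simp add: Zx)
  also have "\<dots> = 0" using kernel by simp
  finally show ?thesis .
qed

text \<open>There are \<open>l + 1\<close> coefficients, each with a block of norm at most 1 and a
  weight |x|^t of at most \<open>max 1 (cmod x ^ l)\<close>.\<close>

lemma block_value_bound:
  assumes "i < Suc \<eta>" "j < Suc \<epsilon>"
  shows "cnorm n (\<lambda>a. \<Sum>b<n. poly (m i a j b) x * f b) \<le> real (Suc l) * max 1 (cmod x ^ l) * cnorm n f"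
proof -
  have "cnorm n (\<lambda>a. \<Sum>b<n. poly (m i a j b) x * f b)
    = cnorm n (\<lambda>a. \<Sum>t\<le>l. x ^ t * (\<Sum>b<n. coeff (m i a j b) t * f b))"
  proof (rule cnorm_cong)
    fix a assume a: "a < n"
    have "(\<Sum>b<n. poly (m i a j b) x * f b) = (\<Sum>b<n. \<Sum>t\<le>l. x ^ t * (coeff (m i a j b) t * f b))"
      using a assms m_degree by (intro sum.cong refl) (subst poly_eq_sum_upto[of l], auto simp: sum_distrib_left mult_ac)
    also have "\<dots> = (\<Sum>t\<le>l. x ^ t * (\<Sum>b<n. coeff (m i a j b) t * f b))"
      by (subst sum.swap) (simp only: sum_distrib_left)
    finally show "(\<Sum>b<n. poly (m i a j b) x * f b) = \<dots>" .
  qed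
  also have "\<dots> \<le> (\<Sum>t\<le>l. cmod x ^ t * cnorm n (\<lambda>a. \<Sum>b<n. coeff (m i a j b) t * f b))"
    by (rule order_trans[OF cnorm_sum]) (simp_all add: cnorm_scale norm_power)
  also have "\<dots> \<le> (\<Sum>t\<le>l. max 1 (cmod x ^ l) * cnorm n f)"
  proof (intro sum_mono mult_mono)
    fix t assume t: "t \<in> {..l}"
    show "cmod x ^ t \<le> max 1 (cmod x ^ l)" using t by (simp add: power_le_max_1)
    let ?A = "mat n n (\<lambda>(a, b). coeff (m i a j b) t)"
    have "cnorm n (\<lambda>a. \<Sum>b<n. coeff (m i a j b) t * f b)
      = cnorm (dim_row ?A) (\<lambda>a. \<Sum>b<dim_col ?A. ?A $$ (a, b) * f b)"
      by (auto intro!: cnorm_cong)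
    also have "\<dots> \<le> mat_norm2 ?A * cnorm n f" using mat_norm2_upper[of ?A f] by simp
    also have "\<dots> \<le> 1 * cnorm n f" using t assms by (intro mult_right_mono m_norm) auto
    finally show "cnorm n (\<lambda>a. \<Sum>b<n. coeff (m i a j b) t * f b) \<le> cnorm n f" by simp
  qed auto
  finally show ?thesis by simp
qed

lemma first_block_bound:
  assumes "j < Suc \<epsilon>"
  shows "cnorm n (\<lambda>b. z (j * n + b)) \<le> max 1 (cmod x ^ l) ^ \<epsilon> * cnorm n (\<lambda>b. z (\<epsilon> * n + b))"
proof -
  have "cnorm n (\<lambda>b. z (j * n + b)) = cnorm n (\<lambda>b. (x ^ l) ^ (\<epsilon> - j) * z (\<epsilon> * n + b))"
    using assms by (intro cnorm_cong kernel_first_blocks)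
  also have "\<dots> = (cmod x ^ l) ^ (\<epsilon> - j) * cnorm n (\<lambda>b. z (\<epsilon> * n + b))"
    unfolding cnorm_scale norm_power ..
  also have "(cmod x ^ l) ^ (\<epsilon> - j) \<le> max 1 (cmod x ^ l) ^ (\<epsilon> - j)"
    by (intro power_mono) auto
  also have "\<dots> \<le> max 1 (cmod x ^ l) ^ \<epsilon>" by (intro power_increasing) auto
  finally show ?thesis by (simp add: mult_right_mono)
qed

text \<open>The top block rows form a bidiagonal system for the remaining blocks: it is solved downwards
  if \<open>\<bar>x\<bar> \<le> 1\<close> and upwards otherwise, so that no power of \<open>x\<close> accumulates.\<close>

lemma second_block_bound:
  assumes j: "j < \<eta>"
  shows "cnorm n (\<lambda>b. z ((Suc \<epsilon> + j) * n + b))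
    \<le> real \<eta> * (real (Suc \<epsilon>) * real (Suc l) * (max 1 (cmod x ^ l) ^ \<epsilon> * cnorm n (\<lambda>b. z (\<epsilon> * n + b))))"
proof -
  define y where "y = x ^ l"
  define Y where "Y = max 1 (cmod x ^ l)"
  define V where "V = cnorm n (\<lambda>b. z (\<epsilon> * n + b))"
  \<comment> \<open>\<open>G * Y\<close> will bound \<open>g i\<close>, the contribution of
    \<open>M\<close> to block row \<open>i\<close>. The factor \<open>Y\<close> is kept apart
    because both recursions remove it: it is 1 in the first and the divisor in the second.\<close>
  define G where "G = real (Suc \<epsilon>) * real (Suc l) * (Y ^ \<epsilon> * V)"
  define g where "g i a = (\<Sum>j<Suc \<epsilon>. \<Sum>b<n. poly (m i a j b) x * z (j * n + b))" for i a
  define h where "h j b = z ((Suc \<epsilon> + j) * n + b)" for j b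
  have Y1: "1 \<le> Y" by (simp add: Y_def)
  have G0: "0 \<le> G" using Y1 by (simp add: G_def V_def)
  have gbound: "cnorm n (g i) \<le> G * Y" if i: "i < Suc \<eta>" for i
  proof -
    have "cnorm n (g i) \<le> (\<Sum>j<Suc \<epsilon>. cnorm n (\<lambda>a. \<Sum>b<n. poly (m i a j b) x * z (j * n + b)))"
      unfolding g_def by (rule cnorm_sum) simp
    also have "\<dots> \<le> (\<Sum>j<Suc \<epsilon>. real (Suc l) * Y * (Y ^ \<epsilon> * V))"
    proof (rule sum_mono)
      fix j assume "j \<in> {..<Suc \<epsilon>}"
      then have j: "j < Suc \<epsilon>" by simp
      have "cnorm n (\<lambda>a. \<Sum>b<n. poly (m i a j b) x * z (j * n + b))
        \<le> real (Suc l) * Y * cnorm n (\<lambda>b. z (j * n + b))"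
        unfolding Y_def by (rule block_value_bound[OF i j])
      also have "\<dots> \<le> real (Suc l) * Y * (Y ^ \<epsilon> * V)"
        using first_block_bound[OF j] Y1 by (intro mult_left_mono) (auto simp: Y_def V_def)
      finally show "cnorm n (\<lambda>a. \<Sum>b<n. poly (m i a j b) x * z (j * n + b))
        \<le> real (Suc l) * Y * (Y ^ \<epsilon> * V)" .
    qed
    also have "\<dots> = G * Y" unfolding G_def by simp
    finally show ?thesis .
  qed
  have row: "g i a + ((if i < \<eta> then - h i a else 0) + (if 0 < i then y * h (i - 1) a else 0)) = 0"
    if i: "i < Suc \<eta>" and a: "a < n" for i a
  proof -
    have "(\<Sum>k<N. poly (Q $$ (i * n + a, k)) x * z k) = poly (\<Sum>k<N. Q $$ (i * n + a, k) * [:z k:]) x"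
      by (simp add: poly_sum mult.commute)
    also have "\<dots> = g i a + (\<Sum>j<\<eta>. poly ((if i = j then - 1 else if i = Suc j then monom 1 l else 0) * [:h j a:]) x)"
      unfolding top_row[OF i a] poly_add poly_sum by (simp add: mult.commute g_def h_def)
    also have "(\<Sum>j<\<eta>. poly ((if i = j then - 1 else if i = Suc j then monom 1 l else 0) * [:h j a:]) x)
      = (\<Sum>j<\<eta>. (if i = j then - 1 else if i = Suc j then y else 0) * h j a)"
      by (intro sum.cong refl) (auto simp: poly_monom y_def)
    also have "\<dots> = (if i < \<eta> then - h i a else 0) + (if 0 < i then y * h (i - 1) a else 0)"
      by (rule bidiagonal_row_sum) (use i in simp)
    finally show ?thesis
      using kernel[of "i * n + a"] block_index_less[of i "\<epsilon> + \<eta> + 1" a n] i a by simp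
  qed
  have "cnorm n (h j) \<le> real \<eta> * G"
  proof (cases "cmod y \<le> 1")
    case True
    then have Y: "Y = 1" by (simp add: Y_def y_def norm_power)
    \<comment> \<open>Row 0 involves only \<open>h 0\<close>. Multiplication by \<open>y\<close>
      does not enlarge the preceding block, so every row adds at most one \<open>G\<close>.\<close>
    have "i < \<eta> \<Longrightarrow> cnorm n (h i) \<le> real (Suc i) * G" for i
    proof (induction i)
      case 0
      have "cnorm n (h 0) = cnorm n (g 0)"
        using row[of 0] 0 by (intro cnorm_cong) (simp add: eq_neg_iff_add_eq_0)
      then show ?case using gbound[of 0] Y by simp
    next
      case (Suc i)
      have "cnorm n (h (Suc i)) = cnorm n (\<lambda>a. g (Suc i) a + y * h i a)"
        using row[of "Suc i"] Suc.prems by (intro cnorm_cong) (simp add: algebra_simps)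
      also have "\<dots> \<le> cnorm n (g (Suc i)) + cmod y * cnorm n (h i)"
        using cnorm_add[of n "g (Suc i)" "\<lambda>a. y * h i a"] by (simp add: cnorm_scale)
      also have "\<dots> \<le> G + 1 * (real (Suc i) * G)"
        using gbound[of "Suc i"] Y Suc True by (intro add_mono mult_mono) auto
      finally show ?case by (simp add: algebra_simps)
    qed
    from this[OF j] have "cnorm n (h j) \<le> real (Suc j) * G" .
    also have "\<dots> \<le> real \<eta> * G" using j G0 by (intro mult_right_mono) auto
    finally show ?thesis .
  next
    case False
    then have Y: "cmod y = Y" by (simp add: Y_def y_def norm_power)
    \<comment> \<open>Here \<open>t\<close> counts from the last block, since row
      \<open>\<eta>\<close> involves only \<open>h (\<eta> - 1)\<close>. Solving for the preceding
      block divides by \<open>y\<close>, of modulus \<open>Y\<close>, which cancels the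
      \<open>Y\<close> of \<open>gbound\<close>.\<close>
    have "t < \<eta> \<Longrightarrow> cnorm n (h (\<eta> - Suc t)) \<le> real (Suc t) * G" for t
    proof (induction t)
      case 0
      have "Y * cnorm n (h (\<eta> - Suc 0)) = cnorm n (\<lambda>a. y * h (\<eta> - 1) a)" by (simp add: cnorm_scale Y)
      also have "\<dots> = cnorm n (\<lambda>a. - g \<eta> a)"
        using row[of \<eta>] 0 by (intro cnorm_cong) (simp add: eq_neg_iff_add_eq_0 add.commute)
      also have "\<dots> \<le> G * Y" using gbound[of \<eta>] by (simp add: cnorm_minus)
      finally show ?case using Y1 by (simp add: mult.commute[of G])
    next
      case (Suc t)
      define i where "i = \<eta> - Suc t"
      have i: "0 < i" "i < \<eta>" "\<eta> - Suc (Suc t) = i - 1" using Suc.prems by (auto simp: i_def)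
      have "Y * cnorm n (h (i - 1)) = cnorm n (\<lambda>a. y * h (i - 1) a)" by (simp add: cnorm_scale Y)
      also have "\<dots> = cnorm n (\<lambda>a. - g i a + h i a)"
        using row[of i] i by (intro cnorm_cong) (simp add: algebra_simps)
      also have "\<dots> \<le> cnorm n (g i) + cnorm n (h i)"
        using cnorm_add[of n "\<lambda>a. - g i a" "h i"] by (simp add: cnorm_minus)
      also have "\<dots> \<le> G * Y + Y * (real (Suc t) * G)"
      proof (rule add_mono)
        have "cnorm n (h i) \<le> 1 * (real (Suc t) * G)" using Suc unfolding i_def by simp
        also have "\<dots> \<le> Y * (real (Suc t) * G)" using Y1 G0 by (intro mult_right_mono) auto
        finally show "cnorm n (h i) \<le> Y * (real (Suc t) * G)" .
      qed (use gbound i in simp)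
      also have "\<dots> = Y * (real (Suc (Suc t)) * G)" by (simp add: algebra_simps)
      finally show ?case using Y1 unfolding i by simp
    qed
    from this[of "\<eta> - Suc j"] have "cnorm n (h j) \<le> real (\<eta> - j) * G" using j by (simp add: Suc_diff_Suc)
    also have "\<dots> \<le> real \<eta> * G" using G0 by (intro mult_right_mono) auto
    finally show ?thesis .
  qed
  then show ?thesis by (simp only: G_def Y_def V_def h_def[abs_def])
qed

text \<open>The constant adds up \<epsilon> + 1 first blocks with factor 1 and \<eta> further blocks
  with factor \<eta> (\<epsilon> + 1) (l + 1), each block count being at most
  \<open>d\<close>.\<close>

lemma kernel_upper_bound:
  assumes d: "\<epsilon> + \<eta> + 1 \<le> d" "l \<le> d"
  shows "cnorm N z \<le> (real d + real d ^ 3 * real (Suc d)) * (max 1 (cmod x ^ l) ^ \<epsilon> * cnorm n (\<lambda>b. z (\<epsilon> * n + b)))"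
proof -
  define T where "T = max 1 (cmod x ^ l) ^ \<epsilon> * cnorm n (\<lambda>b. z (\<epsilon> * n + b))"
  have T: "0 \<le> T" by (simp add: T_def)
  have N: "N = (Suc \<epsilon> + \<eta>) * n" by simp
  have "cnorm N z \<le> (\<Sum>j<Suc \<epsilon>. cnorm n (\<lambda>b. z (j * n + b))) + (\<Sum>j<\<eta>. cnorm n (\<lambda>b. z ((Suc \<epsilon> + j) * n + b)))"
    unfolding N using cnorm_blocks_le[of "Suc \<epsilon> + \<eta>" n z] unfolding sum_lessThan_add .
  also have "\<dots> \<le> (\<Sum>j<Suc \<epsilon>. T) + (\<Sum>j<\<eta>. real \<eta> * (real (Suc \<epsilon>) * real (Suc l) * T))"
    unfolding T_def by (intro add_mono sum_mono first_block_bound second_block_bound) auto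
  also have "\<dots> = (real (Suc \<epsilon>) + real \<eta> * real \<eta> * (real (Suc \<epsilon>) * real (Suc l))) * T"
    by (simp add: algebra_simps)
  also have "\<dots> \<le> (real d + real d * real d * (real d * real (Suc d))) * T"
    using d T by (intro mult_right_mono add_mono mult_mono) auto
  finally show ?thesis by (simp add: T_def power3_eq_cube mult.assoc)
qed

text \<open>A single block suffices: block \<epsilon> if |x|^l is at most 1, and otherwise block 0,
  which is block \<epsilon> times the full power (x^l)^\<epsilon>.\<close>

lemma kernel_lower_bound:
  "max 1 (cmod x ^ l) ^ \<epsilon> * cnorm n (\<lambda>b. z (\<epsilon> * n + b)) \<le> cnorm N z"
proof (cases "cmod x ^ l \<le> 1")
  case True
  then show ?thesis using cnorm_block_le[of \<epsilon> "\<epsilon> + \<eta> + 1" n z] by simp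
next
  case False
  have "cnorm n (\<lambda>b. z (0 * n + b)) = cnorm n (\<lambda>b. (x ^ l) ^ (\<epsilon> - 0) * z (\<epsilon> * n + b))"
    by (intro cnorm_cong kernel_first_blocks) auto
  then have "cnorm n (\<lambda>b. z (0 * n + b)) = (cmod x ^ l) ^ \<epsilon> * cnorm n (\<lambda>b. z (\<epsilon> * n + b))"
    unfolding cnorm_scale norm_power by simp
  then show ?thesis using False cnorm_block_le[of 0 "\<epsilon> + \<eta> + 1" n z] by simp
qed

text \<open>Lift \<open>w\<close> and \<open>z\<close> to polynomial vectors \<open>W\<close> and
  \<open>Z\<close> as in \<open>bilinear_identity\<close> and differentiate that identity at
  \<open>x\<close>. The product rule yields two extra terms, with the derivative of \<open>W\<close>
  or of \<open>Z\<close>; they vanish because Q(x) z = 0 and w^T Q(x) = 0. The assumed shape of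
  \<open>w\<close> is what the transposed form supplies.\<close>

lemma derivative_pairing:
  assumes left_kernel: "\<And>k'. k' < N \<Longrightarrow> (\<Sum>k<N. poly (Q $$ (k, k')) x * w k) = 0"
    and w: "\<And>i a. i < Suc \<eta> \<Longrightarrow> a < n \<Longrightarrow> w (i * n + a) = (x ^ l) ^ (\<eta> - i) * w (\<eta> * n + a)"
  shows "(\<Sum>k<N. \<Sum>k'<N. w k * poly (pderiv (Q $$ (k, k'))) x * z k')
    = (\<Sum>a<n. \<Sum>b<n. w (\<eta> * n + a) * poly (pderiv (P $$ (a, b))) x * z (\<epsilon> * n + b))"
proof -
  define W where "W k = (if k div n < Suc \<eta> then monom 1 l ^ (\<eta> - k div n) * [:w (\<eta> * n + k mod n):] else [:w k:])" for k
  define Z where "Z k = (if k div n < Suc \<epsilon> then monom 1 l ^ (\<epsilon> - k div n) * [:z (\<epsilon> * n + k mod n):] else [:z k:])" for k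
  have n: "0 < n" if "k < N" for k using that by (cases n) auto
  have Zx: "poly (Z k) x = z k" if "k < N" for k
  proof (cases "k div n < Suc \<epsilon>")
    case True
    have "k mod n < n" using n[OF that] by simp
    from kernel_first_blocks[OF True this] show ?thesis
      using True by (simp add: Z_def poly_monom poly_power del: power_mult)
  qed (simp add: Z_def)
  have Wx: "poly (W k) x = w k" if "k < N" for k
  proof (cases "k div n < Suc \<eta>")
    case True
    have "k mod n < n" using n[OF that] by simp
    from w[OF True this] show ?thesis
      using True by (simp add: W_def poly_monom poly_power del: power_mult)
  qed (simp add: W_def)
  have identity: "(\<Sum>k<N. \<Sum>k'<N. W k * Q $$ (k, k') * Z k')
    = (\<Sum>a<n. \<Sum>b<n. [:w (\<eta> * n + a):] * P $$ (a, b) * [:z (\<epsilon> * n + b):])"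
    by (rule bilinear_identity) (simp_all add: W_def Z_def)
  have "(\<Sum>a<n. \<Sum>b<n. w (\<eta> * n + a) * poly (pderiv (P $$ (a, b))) x * z (\<epsilon> * n + b))
    = poly (pderiv (\<Sum>a<n. \<Sum>b<n. [:w (\<eta> * n + a):] * P $$ (a, b) * [:z (\<epsilon> * n + b):])) x"
    by (simp add: pderiv_sum pderiv_smult poly_sum mult_ac)
  also have "\<dots> = (\<Sum>k<N. \<Sum>k'<N. w k * poly (pderiv (Q $$ (k, k'))) x * z k'
      + poly (pderiv (W k)) x * (poly (Q $$ (k, k')) x * z k')
      + poly (pderiv (Z k')) x * (poly (Q $$ (k, k')) x * w k))"
    unfolding identity[symmetric] pderiv_sum poly_sum
    by (intro sum.cong refl) (simp add: pderiv_mult Wx Zx algebra_simps)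
  also have "\<dots> = (\<Sum>k<N. \<Sum>k'<N. w k * poly (pderiv (Q $$ (k, k'))) x * z k')
      + (\<Sum>k<N. poly (pderiv (W k)) x * (\<Sum>k'<N. poly (Q $$ (k, k')) x * z k'))
      + (\<Sum>k<N. \<Sum>k'<N. poly (pderiv (Z k')) x * (poly (Q $$ (k, k')) x * w k))"
    by (simp only: sum.distrib sum_distrib_left)
  also have "(\<Sum>k<N. \<Sum>k'<N. poly (pderiv (Z k')) x * (poly (Q $$ (k, k')) x * w k))
    = (\<Sum>k'<N. poly (pderiv (Z k')) x * (\<Sum>k<N. poly (Q $$ (k, k')) x * w k))"
    by (subst sum.swap) (simp only: sum_distrib_left)
  finally show ?thesis using kernel left_kernel by simp
qed

end

section \<open>The weighted sum of the coefficient norms\<close>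

lemma coeff_norm_le:
  assumes t: "t \<le> l"
  shows "mat_norm2 (mpoly_coeff Q t) \<le> real (\<epsilon> + \<eta> + 1) * real (\<epsilon> + \<eta> + 1) * 1"
proof (rule mat_norm2_blocks)
  show "mpoly_coeff Q t \<in> carrier_mat N N" using Q_carrier by (simp add: mpoly_coeff_def)
  fix i j assume i: "i < \<epsilon> + \<eta> + 1" and j: "j < \<epsilon> + \<eta> + 1"
  have entry: "mat_block n (mpoly_coeff Q t) i j = mat n n (\<lambda>(a, b). coeff (Q $$ (i * n + a, j * n + b)) t)"
    using Q_carrier block_index_less[OF i] block_index_less[OF j]
    by (intro eq_matI) (auto simp: mat_block_def mpoly_coeff_def)
  have scalar: "mat_norm2 (mat_block n (mpoly_coeff Q t) i j) \<le> 1"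
    if "\<And>a b. a < n \<Longrightarrow> b < n \<Longrightarrow> Q $$ (i * n + a, j * n + b) = (if a = b then c else 0)"
      "c = - 1 \<or> c = monom 1 l \<or> c = 0" for c
  proof -
    have "mat_block n (mpoly_coeff Q t) i j = mat n n (\<lambda>(a, b). if a = b then coeff c t else 0)"
      unfolding entry using that(1) by (intro eq_matI) auto
    moreover have "cmod (coeff c t) \<le> 1" using that(2) by (auto simp: coeff_1)
    ultimately show ?thesis by (simp add: mat_norm2_scalar_mat)
  qed
  show "mat_norm2 (mat_block n (mpoly_coeff Q t) i j) \<le> 1"
  proof (cases "i < Suc \<eta>")
    case i1: True
    show ?thesis
    proof (cases "j < Suc \<epsilon>")
      case True
      have "mat_block n (mpoly_coeff Q t) i j = mat n n (\<lambda>(a, b). coeff (m i a j b) t)"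
        unfolding entry using Q_11[OF i1 True] by (intro eq_matI) auto
      then show ?thesis using m_norm[OF i1 True t] by simp
    next
      case False
      define j' where "j' = j - Suc \<epsilon>"
      have j': "j = Suc \<epsilon> + j'" "j' < \<eta>" using False j by (auto simp: j'_def)
      show ?thesis
        by (rule scalar[of "if i = j' then - 1 else if i = Suc j' then monom 1 l else 0"])
          (simp_all only: j' Q_12[OF i1 j'(2)], simp_all)
    qed
  next
    case False
    define i' where "i' = i - Suc \<eta>"
    have i': "i = Suc \<eta> + i'" "i' < \<epsilon>" using False i by (auto simp: i'_def)
    show ?thesis
    proof (cases "j < Suc \<epsilon>")
      case True
      show ?thesis
        by (rule scalar[of "if j = i' then - 1 else if j = Suc i' then monom 1 l else 0"])
          (simp_all only: i' Q_21[OF i'(2) True], simp_all)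
    next
      case False
      define j' where "j' = j - Suc \<epsilon>"
      have j': "j = Suc \<epsilon> + j'" "j' < \<eta>" using False j by (auto simp: j'_def)
      show ?thesis
        by (rule scalar[of 0]) (simp_all only: i' j' Q_22[OF i'(2) j'(2)], simp_all)
    qed
  qed
qed simp

lemma weighted_norm_sum_upper:
  "(\<Sum>t\<le>l. cmod x ^ t * mat_norm2 (mpoly_coeff Q t))
    \<le> real (Suc l) * (real (\<epsilon> + \<eta> + 1))\<^sup>2 * max 1 (cmod x ^ l)"
proof -
  have "(\<Sum>t\<le>l. cmod x ^ t * mat_norm2 (mpoly_coeff Q t))
    \<le> (\<Sum>t\<le>l. max 1 (cmod x ^ l) * (real (\<epsilon> + \<eta> + 1))\<^sup>2)"
    using coeff_norm_le
    by (intro sum_mono mult_mono power_le_max_1 mat_norm2_nonneg) (auto simp: power2_eq_square)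
  then show ?thesis by (simp add: mult_ac)
qed

lemma weighted_norm_sum_lower:
  assumes n: "0 < n" and blocks: "0 < \<epsilon> + \<eta>"
  shows "max 1 (cmod x ^ l) \<le> (\<Sum>t\<le>l. cmod x ^ t * mat_norm2 (mpoly_coeff Q t))"
proof -
  \<comment> \<open>An entry \<open>- 1\<close> contributes 1 through coefficient 0, an entry
    \<open>monom 1 l\<close> contributes |x|^l through coefficient \<open>l\<close>. Both are taken
    from the block L_\<eta>^T if \<epsilon> = 0 and from L_\<epsilon> otherwise.\<close>
  obtain k k1 k2 k3 where k: "k < N" "k1 < N" "k2 < N" "k3 < N"
    "Q $$ (k, k1) = - 1" "Q $$ (k2, k3) = monom 1 l"
  proof (cases "\<epsilon> = 0")
    case True
    show ?thesis
    proof (rule that[of "0 * n + 0" "(Suc \<epsilon> + 0) * n + 0" "1 * n + 0" "(Suc \<epsilon> + 0) * n + 0"])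
      show "Q $$ (0 * n + 0, (Suc \<epsilon> + 0) * n + 0) = - 1" "Q $$ (1 * n + 0, (Suc \<epsilon> + 0) * n + 0) = monom 1 l"
        using True n blocks by (subst Q_12; simp)+
    qed (rule block_index_less; use True n blocks in simp)+
  next
    case False
    show ?thesis
    proof (rule that[of "(Suc \<eta> + 0) * n + 0" "0 * n + 0" "(Suc \<eta> + 0) * n + 0" "1 * n + 0"])
      show "Q $$ ((Suc \<eta> + 0) * n + 0, 0 * n + 0) = - 1" "Q $$ ((Suc \<eta> + 0) * n + 0, 1 * n + 0) = monom 1 l"
        using False n blocks by (subst Q_21; simp)+
    qed (rule block_index_less; use False n blocks in simp)+
  qed
  have c0: "1 \<le> mat_norm2 (mpoly_coeff Q 0)"
    using mat_norm2_ge_entry[of k "mpoly_coeff Q 0" k1] k Q_carrier by (simp add: mpoly_coeff_def)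
  have cl: "1 \<le> mat_norm2 (mpoly_coeff Q l)"
    using mat_norm2_ge_entry[of k2 "mpoly_coeff Q l" k3] k Q_carrier by (simp add: mpoly_coeff_def)
  have summand: "cmod x ^ t * mat_norm2 (mpoly_coeff Q t) \<le> (\<Sum>t\<le>l. cmod x ^ t * mat_norm2 (mpoly_coeff Q t))"
    if "t \<le> l" for t
    using that by (intro member_le_sum) (auto intro!: mult_nonneg_nonneg mat_norm2_nonneg)
  have "cmod x ^ l * 1 \<le> cmod x ^ l * mat_norm2 (mpoly_coeff Q l)" using cl by (intro mult_left_mono) auto
  then show ?thesis using c0 summand[of 0] summand[of l] by simp
qed

end

subsection \<open>Condition numbers\<close>

lemma poly_mat_kernel_iff:
  assumes Q: "Q \<in> carrier_mat N N" and z: "z \<in> carrier_vec N"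
  shows "mpoly_eval Q x *\<^sub>v z = 0\<^sub>v N \<longleftrightarrow> (\<forall>k<N. (\<Sum>k'<N. poly (Q $$ (k, k')) x * z $ k') = 0)"
proof -
  have "(mpoly_eval Q x *\<^sub>v z) $ k = (\<Sum>k'<N. poly (Q $$ (k, k')) x * z $ k')" if "k < N" for k
    using that Q z by (auto simp: mpoly_eval_def scalar_prod_def lessThan_atLeast0)
  then show ?thesis using Q by (auto simp: vec_eq_iff mpoly_eval_def)
qed

lemma right_eigenvectorD:
  assumes "Q \<in> carrier_mat N N" "right_eigenvector Q x z"
  shows "z \<in> carrier_vec N" "\<exists>k<N. z $ k \<noteq> 0" "\<And>k. k < N \<Longrightarrow> (\<Sum>k'<N. poly (Q $$ (k, k')) x * z $ k') = 0"
  using assms poly_mat_kernel_iff[of Q N z x] by (auto simp: right_eigenvector_def vec_eq_iff)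

text \<open>The conjugate is absorbed into the vector here, so that all later pairings are bilinear
  and transposition alone exchanges left and right.\<close>

lemma left_eigenvectorD:
  assumes Q: "Q \<in> carrier_mat N N" and w: "left_eigenvector Q x w"
  shows "w \<in> carrier_vec N" "\<exists>k<N. cnj (w $ k) \<noteq> 0" "\<And>k. k < N \<Longrightarrow> (\<Sum>k'<N. poly (Q $$ (k', k)) x * cnj (w $ k')) = 0"
proof -
  show wN: "w \<in> carrier_vec N" and "\<exists>k<N. cnj (w $ k) \<noteq> 0"
    using assms by (auto simp: left_eigenvector_def vec_eq_iff)
  have "transpose_mat (mpoly_eval Q x) = mpoly_eval (transpose_mat Q) x"
    using Q by (intro eq_matI) (auto simp: mpoly_eval_def)
  then have "\<forall>k<N. (\<Sum>k'<N. poly (transpose_mat Q $$ (k, k')) x * conjugate w $ k') = 0"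
    using poly_mat_kernel_iff[of "transpose_mat Q" N "conjugate w" x] wN Q w
    by (simp add: left_eigenvector_def)
  moreover have "(\<Sum>k'<N. poly (transpose_mat Q $$ (k, k')) x * conjugate w $ k')
    = (\<Sum>k'<N. poly (Q $$ (k', k)) x * cnj (w $ k'))" if "k < N" for k
    using that Q wN by (intro sum.cong) auto
  ultimately show "\<And>k. k < N \<Longrightarrow> (\<Sum>k'<N. poly (Q $$ (k', k)) x * cnj (w $ k')) = 0" by auto
qed

text \<open>Isolates the weighted norm sum from a factor that, for \<open>Q = P\<close>, does not
  involve the grade \<open>l\<close>.\<close>

lemma coeff_cond_eq:
  assumes Q: "Q \<in> carrier_mat N N" and z: "z \<in> carrier_vec N" and w: "w \<in> carrier_vec N"
  shows "coeff_cond l Q x z w = (\<Sum>t\<le>l. cmod x ^ t * mat_norm2 (mpoly_coeff Q t))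
    * (cnorm N (\<lambda>k. z $ k) * cnorm N (\<lambda>k. cnj (w $ k))
      / (cmod x * cmod (\<Sum>k<N. \<Sum>k'<N. cnj (w $ k) * poly (pderiv (Q $$ (k, k'))) x * z $ k')))"
proof -
  have "conjugate w \<bullet> (mpoly_eval (mpoly_deriv Q) x *\<^sub>v z)
    = (\<Sum>k<N. cnj (w $ k) * (\<Sum>k'<N. poly (pderiv (Q $$ (k, k'))) x * z $ k'))"
    using Q z w by (auto simp: scalar_prod_def mpoly_eval_def mpoly_deriv_def lessThan_atLeast0 intro!: sum.cong)
  also have "\<dots> = (\<Sum>k<N. \<Sum>k'<N. cnj (w $ k) * poly (pderiv (Q $$ (k, k'))) x * z $ k')"
    by (simp only: sum_distrib_left mult.assoc)
  finally show ?thesis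
    using z w by (simp add: coeff_cond_def vec_norm2_eq_cnorm cnorm_cnj mult_ac)
qed

text \<open>The factor of the condition number that depends on \<open>P\<close> alone; \<open>u\<close> is the conjugate of a left
  eigenvector.\<close>

definition eigen_factor :: "nat \<Rightarrow> complex poly mat \<Rightarrow> complex \<Rightarrow> (nat \<Rightarrow> complex) \<Rightarrow> (nat \<Rightarrow> complex) \<Rightarrow> real" where
  "eigen_factor n P x u v = cnorm n v * cnorm n u
    / (cmod x * cmod (\<Sum>a<n. \<Sum>b<n. u a * poly (pderiv (P $$ (a, b))) x * v b))"

definition null_pair :: "nat \<Rightarrow> complex poly mat \<Rightarrow> complex \<Rightarrow> (nat \<Rightarrow> complex) \<Rightarrow> (nat \<Rightarrow> complex) \<Rightarrow> bool" where
  "null_pair n P x u v \<longleftrightarrow> (\<exists>a<n. u a \<noteq> 0) \<and> (\<exists>b<n. v b \<noteq> 0) \<and>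
    (\<forall>b<n. (\<Sum>a<n. poly (P $$ (a, b)) x * u a) = 0) \<and> (\<forall>a<n. (\<Sum>b<n. poly (P $$ (a, b)) x * v b) = 0)"

text \<open>Simplicity of \<open>x\<close> keeps the pairing in the denominator away from zero;
  positivity is what allows the factor to be cancelled from the ratio of two condition
  numbers.\<close>

lemma eigen_factor_pos:
  assumes "P \<in> carrier_mat n n" "simple_mpoly_eigenvalue P x" "x \<noteq> 0" "null_pair n P x u v"
  shows "0 < eigen_factor n P x u v"
proof -
  obtain a b where ab: "a < n" "u a \<noteq> 0" "b < n" "v b \<noteq> 0" using assms(4) by (auto simp: null_pair_def)
  have "(\<Sum>i<n. \<Sum>j<n. u i * poly (pderiv (P $$ (i, j))) x * v j) \<noteq> 0"
    using assms ab by (intro simple_eigenvalue_pairing_nonzero[where k = b and m = a]) (auto simp: null_pair_def)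
  moreover have "0 < cnorm n u" "0 < cnorm n v"
    using ab cnorm_eq_0_iff[of n u] cnorm_eq_0_iff[of n v] cnorm_nonneg[of n u] cnorm_nonneg[of n v] by (metis less_le)+
  ultimately show ?thesis using assms(3) by (simp add: eigen_factor_def)
qed

text \<open>Both null spaces are lines, and the scalars relating the two pairs occur once in the
  numerator and once in the denominator. Thus the pairs extracted from two different forms become
  comparable.\<close>

lemma eigen_factor_unique:
  assumes P: "P \<in> carrier_mat n n" and simple: "simple_mpoly_eigenvalue P x"
    and uv: "null_pair n P x u v" and uv': "null_pair n P x u' v'"
  shows "eigen_factor n P x u' v' = eigen_factor n P x u v"
proof -
  obtain a b where ab: "a < n" "u a \<noteq> 0" "b < n" "v b \<noteq> 0" using uv by (auto simp: null_pair_def)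
  have Pt: "transpose_mat P \<in> carrier_mat n n" using P by simp
  have simple_t: "simple_mpoly_eigenvalue (transpose_mat P) x"
    using simple P by (auto simp: simple_mpoly_eigenvalue_def mpoly_regular_def det_transpose[OF P])
  obtain c where c: "\<And>i. i < n \<Longrightarrow> v' i = c * v i"
    using uv uv' ab by (rule_tac simple_eigenvalue_kernel_line[OF P simple, of v v' u b a]) (auto simp: null_pair_def)
  have tr: "(\<Sum>j<n. poly (transpose_mat P $$ (i, j)) x * f j) = (\<Sum>j<n. poly (P $$ (j, i)) x * f j)"
    "(\<Sum>j<n. poly (transpose_mat P $$ (j, i)) x * f j) = (\<Sum>j<n. poly (P $$ (i, j)) x * f j)" if "i < n" for f i
    using that P by auto
  obtain e where e: "\<And>i. i < n \<Longrightarrow> u' i = e * u i"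
    using uv uv' ab by (rule_tac simple_eigenvalue_kernel_line[OF Pt simple_t, of u u' v a b]) (auto simp: null_pair_def tr)
  have ne: "c \<noteq> 0" "e \<noteq> 0" using uv' c e by (auto simp: null_pair_def)
  have "cnorm n v' = cmod c * cnorm n v" "cnorm n u' = cmod e * cnorm n u"
    unfolding cnorm_scale[symmetric] using c e by (auto intro!: cnorm_cong)
  moreover have "(\<Sum>a<n. \<Sum>b<n. u' a * poly (pderiv (P $$ (a, b))) x * v' b)
    = (\<Sum>a<n. \<Sum>b<n. e * c * (u a * poly (pderiv (P $$ (a, b))) x * v b))"
    by (intro sum.cong refl) (simp add: c e)
  then have "(\<Sum>a<n. \<Sum>b<n. u' a * poly (pderiv (P $$ (a, b))) x * v' b)
    = e * c * (\<Sum>a<n. \<Sum>b<n. u a * poly (pderiv (P $$ (a, b))) x * v b)"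
    by (simp only: sum_distrib_left)
  ultimately show ?thesis using ne by (simp add: eigen_factor_def norm_mult)
qed

lemma (in block_kronecker_form) coeff_cond_bounds:
  assumes d: "0 < d" "0 < l" "l dvd d" "\<epsilon> + \<eta> + 1 = d div l" and blocks: "0 < \<epsilon> + \<eta>"
    and z: "right_eigenvector Q x z" and w: "left_eigenvector Q x w"
  obtains u v \<tau> where "null_pair n P x u v" "coeff_cond l Q x z w = \<tau> * eigen_factor n P x u v"
    "max 1 (cmod x) ^ d \<le> \<tau>"
    "\<tau> \<le> real (Suc d) * (real d)\<^sup>2 * (real d + real d ^ 3 * real (Suc d))\<^sup>2 * max 1 (cmod x) ^ d"
proof -
  interpret T: block_kronecker_form n l \<eta> \<epsilon> "transpose_mat P" "transpose_mat Q" "\<lambda>i a j b. m j b i a"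
    by (rule transposed)
  have TN: "T.N = N" by (simp add: add.commute)
  note zD = right_eigenvectorD[OF Q_carrier z]
  note wD = left_eigenvectorD[OF Q_carrier w]
  define f where "f k = z $ k" for k
  define g where "g k = cnj (w $ k)" for k
  define v where "v b = f (\<epsilon> * n + b)" for b
  define u where "u a = g (\<eta> * n + a)" for a
  define Y where "Y = max 1 (cmod x ^ l)"
  define K where "K = real d + real d ^ 3 * real (Suc d)"
  define S where "S = (\<Sum>t\<le>l. cmod x ^ t * mat_norm2 (mpoly_coeff Q t))"
  have Y1: "1 \<le> Y" by (simp add: Y_def)
  have n: "0 < n" using zD(2) by (cases n) auto
  have ld: "l \<le> d" using d by (simp add: dvd_imp_le)
  have pd: "\<epsilon> + \<eta> + 1 \<le> d" unfolding d(4) by (rule div_le_dividend)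
  have pd': "\<eta> + \<epsilon> + 1 \<le> d" using pd by simp
  have fker: "\<And>k. k < N \<Longrightarrow> (\<Sum>k'<N. poly (Q $$ (k, k')) x * f k') = 0"
    using zD(3) by (simp only: f_def)
  have gker: "\<And>k. k < N \<Longrightarrow> (\<Sum>k'<N. poly (Q $$ (k', k)) x * g k') = 0"
    using wD(3) by (simp only: g_def)
  have gker': "\<And>k. k < T.N \<Longrightarrow> (\<Sum>k'<T.N. poly (transpose_mat Q $$ (k, k')) x * g k') = 0"
  proof -
    fix k assume "k < T.N"
    then have k: "k < N" by (simp only: TN)
    have "(\<Sum>k'<N. poly (transpose_mat Q $$ (k, k')) x * g k') = (\<Sum>k'<N. poly (Q $$ (k', k)) x * g k')"
      using k Q_carrier by (intro sum.cong) auto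
    then show "(\<Sum>k'<T.N. poly (transpose_mat Q $$ (k, k')) x * g k') = 0" using gker[OF k] by (simp only: TN)
  qed
  have gblocks: "g (i * n + a) = (x ^ l) ^ (\<eta> - i) * g (\<eta> * n + a)" if "i < Suc \<eta>" "a < n" for i a
    by (rule T.kernel_first_blocks[OF gker' that])
  have fbound: "Y ^ \<epsilon> * cnorm n v \<le> cnorm N f" "cnorm N f \<le> K * (Y ^ \<epsilon> * cnorm n v)"
    using kernel_lower_bound[OF fker] kernel_upper_bound[OF fker pd ld] by (simp_all only: Y_def K_def v_def[abs_def])
  have gbound: "Y ^ \<eta> * cnorm n u \<le> cnorm N g" "cnorm N g \<le> K * (Y ^ \<eta> * cnorm n u)"
    using T.kernel_lower_bound[OF gker'] T.kernel_upper_bound[OF gker' pd' ld]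
    by (simp_all only: Y_def K_def u_def[abs_def] TN)
  have fg0: "cnorm N f \<noteq> 0" "cnorm N g \<noteq> 0"
    using zD(2) wD(2) by (auto simp: cnorm_eq_0_iff f_def g_def)
  \<comment> \<open>A vanishing block \<open>v\<close> or \<open>u\<close> would force the whole
    eigenvector to vanish, by the upper bounds just obtained.\<close>
  have uv0: "cnorm n v \<noteq> 0" "cnorm n u \<noteq> 0"
    using fg0 fbound(2) gbound(2) by (metis antisym cnorm_nonneg mult_zero_right)+
  then have uvpos: "0 < cnorm n v" "0 < cnorm n u" using cnorm_nonneg[of n v] cnorm_nonneg[of n u] by linarith+
  have null: "null_pair n P x u v"
    unfolding null_pair_def
  proof (intro conjI allI impI)
    show "\<exists>a<n. u a \<noteq> 0" "\<exists>b<n. v b \<noteq> 0" using uv0 by (auto simp: cnorm_eq_0_iff)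
    fix a assume a: "a < n"
    show "(\<Sum>b<n. poly (P $$ (a, b)) x * v b) = 0"
      unfolding v_def by (rule kernel_last_block[OF fker a])
    have "(\<Sum>b<n. poly (transpose_mat P $$ (a, b)) x * u b) = 0"
      unfolding u_def by (rule T.kernel_last_block[OF gker' a])
    moreover have "(\<Sum>b<n. poly (transpose_mat P $$ (a, b)) x * u b) = (\<Sum>b<n. poly (P $$ (b, a)) x * u b)"
      using a P_carrier by (intro sum.cong) auto
    ultimately show "(\<Sum>b<n. poly (P $$ (b, a)) x * u b) = 0" by simp
  qed
  \<comment> \<open>The denominators for \<open>Q\<close> and \<open>P\<close> agree by the pairing
    identity, so \<tau> only compares numerators: the weighted sum times the growth of each
    eigenvector relative to its block.\<close>
  define \<tau> where "\<tau> = S * (cnorm N f / cnorm n v) * (cnorm N g / cnorm n u)"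
  have pairing: "(\<Sum>k<N. \<Sum>k'<N. g k * poly (pderiv (Q $$ (k, k'))) x * f k')
    = (\<Sum>a<n. \<Sum>b<n. u a * poly (pderiv (P $$ (a, b))) x * v b)"
    unfolding u_def v_def by (rule derivative_pairing[OF fker gker gblocks])
  have cond: "coeff_cond l Q x z w = \<tau> * eigen_factor n P x u v"
    using uv0 unfolding coeff_cond_eq[OF Q_carrier zD(1) wD(1)] f_def[symmetric] g_def[symmetric] pairing
      eigen_factor_def \<tau>_def S_def[symmetric] by (simp only: field_simps) simp
  have Slow: "Y \<le> S" using weighted_norm_sum_lower[OF n blocks] by (simp only: Y_def S_def)
  have "S \<le> real (Suc l) * (real (\<epsilon> + \<eta> + 1))\<^sup>2 * Y" using weighted_norm_sum_upper by (simp only: Y_def S_def)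
  also have "\<dots> \<le> real (Suc d) * (real d)\<^sup>2 * Y"
    using ld pd Y1 by (intro mult_right_mono mult_mono power_mono) auto
  finally have Sup: "S \<le> real (Suc d) * (real d)\<^sup>2 * Y" .
  have f1: "Y ^ \<epsilon> \<le> cnorm N f / cnorm n v" "cnorm N f / cnorm n v \<le> K * Y ^ \<epsilon>"
    using fbound uvpos by (simp_all only: pos_le_divide_eq pos_divide_le_eq mult.assoc)
  have g1: "Y ^ \<eta> \<le> cnorm N g / cnorm n u" "cnorm N g / cnorm n u \<le> K * Y ^ \<eta>"
    using gbound uvpos by (simp_all only: pos_le_divide_eq pos_divide_le_eq mult.assoc)
  have K0: "0 \<le> K" by (simp add: K_def)
  have "Y = max 1 (cmod x) ^ l"
    using power_mono[of 1 "cmod x" l] power_le_one[of "cmod x" l] by (auto simp: Y_def max_def)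
  then have "max 1 (cmod x) ^ d = Y ^ (d div l)"
    using d(3) by (simp only: power_mult[symmetric] dvd_mult_div_cancel)
  then have X: "max 1 (cmod x) ^ d = Y * Y ^ \<epsilon> * Y ^ \<eta>" unfolding d(4)[symmetric] by (simp add: power_add)
  have "max 1 (cmod x) ^ d \<le> \<tau>"
    unfolding X \<tau>_def using Slow f1 g1 Y1 by (intro mult_mono) auto
  moreover have "\<tau> \<le> (real (Suc d) * (real d)\<^sup>2 * Y) * (K * Y ^ \<epsilon>) * (K * Y ^ \<eta>)"
    unfolding \<tau>_def using Slow Sup f1 g1 Y1 K0 by (intro mult_mono) auto
  then have "\<tau> \<le> real (Suc d) * (real d)\<^sup>2 * K\<^sup>2 * max 1 (cmod x) ^ d"
    unfolding X by (simp only: power2_eq_square mult_ac)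
  ultimately show thesis unfolding K_def by (rule that[OF null cond])
qed

section \<open>From the matrix definition to the entrywise form\<close>

lemma kronecker_one_mat_index:
  assumes "i < dim_row A" "j < dim_col A" "a < n" "b < n"
  shows "kronecker A (1\<^sub>m n) $$ (i * n + a, j * n + b) = (if a = b then A $$ (i, j) else 0)"
  using assms block_index_less[of i "dim_row A" a n] block_index_less[of j "dim_col A" b n]
  by (auto simp: kronecker_def)

lemma mult_mat_index:
  assumes "A \<in> carrier_mat p q" "B \<in> carrier_mat q r" "i < p" "j < r"
  shows "(A * B) $$ (i, j) = (\<Sum>k<q. A $$ (i, k) * B $$ (k, j))"
  using assms by (auto simp: scalar_prod_def lessThan_atLeast0)

text \<open>The companion condition and the scaling are condensed into one bound: a block of a
  coefficient of \<open>M\<close> is 0, I or some A_k, and each of these has norm at most 1.\<close>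

lemma block_kronecker_companionE:
  assumes companion: "block_kronecker_companion d n l P Q" and P: "P \<in> carrier_mat n n"
    and norms: "\<And>k. k \<le> d \<Longrightarrow> mat_norm2 (mpoly_coeff P k) \<le> 1"
  obtains \<epsilon> \<eta> m where "block_kronecker_form n l \<epsilon> \<eta> P Q m" "\<epsilon> + \<eta> + 1 = d div l"
proof -
  obtain \<epsilon> \<eta> M where bk: "block_kronecker_ification d n l \<epsilon> \<eta> P M Q"
    and blocks: "\<And>t i j. t \<le> l \<Longrightarrow> i \<le> \<eta> \<Longrightarrow> j \<le> \<epsilon> \<Longrightarrow> mat_block n (mpoly_coeff M t) i j
      \<in> {0\<^sub>m n n, 1\<^sub>m n} \<union> {mpoly_coeff P k | k. k \<le> d}"
    using companion unfolding block_kronecker_companion_def by blast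
  let ?q = "monom 1 l :: complex poly"
  let ?A = "kronecker (transpose_mat (Lambda_mat \<eta> ?q)) (1\<^sub>m n)"
  let ?B = "kronecker (Lambda_mat \<epsilon> ?q) (1\<^sub>m n)"
  have dims: "\<epsilon> + \<eta> + 1 = d div l" and M: "M \<in> carrier_mat (Suc \<eta> * n) (Suc \<epsilon> * n)"
    and Mdeg: "\<And>t. l < t \<Longrightarrow> mpoly_coeff M t = 0\<^sub>m (Suc \<eta> * n) (Suc \<epsilon> * n)"
    and Pprod: "?A * M * ?B = P"
    and Q: "Q = four_block_mat M (kronecker (transpose_mat (L_mat \<eta> ?q)) (1\<^sub>m n))
      (kronecker (L_mat \<epsilon> ?q) (1\<^sub>m n)) (0\<^sub>m (\<epsilon> * n) (\<eta> * n))"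
    using bk unfolding block_kronecker_ification_def by auto
  define m where "m i a j b = M $$ (i * n + a, j * n + b)" for i a j b
  have A: "?A \<in> carrier_mat n (Suc \<eta> * n)" and B: "?B \<in> carrier_mat (Suc \<epsilon> * n) n"
    by (auto simp: kronecker_def Lambda_mat_def)
  have A_entry: "?A $$ (a, i * n + a') = (if a' = a then ?q ^ (\<eta> - i) else 0)" if "i < Suc \<eta>" "a < n" "a' < n" for a i a'
    using kronecker_one_mat_index[of 0 "transpose_mat (Lambda_mat \<eta> ?q)" i a n a'] that by (auto simp: Lambda_mat_def)
  have B_entry: "?B $$ (j * n + b', b) = (if b' = b then ?q ^ (\<epsilon> - j) else 0)" if "j < Suc \<epsilon>" "b < n" "b' < n" for b j b'
    using kronecker_one_mat_index[of j "Lambda_mat \<epsilon> ?q" 0 b' n b] that by (auto simp: Lambda_mat_def)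
  have idx: "\<And>i a. i < Suc \<eta> \<Longrightarrow> a < n \<Longrightarrow> i * n + a < Suc \<eta> * n"
    "\<And>j b. j < Suc \<epsilon> \<Longrightarrow> b < n \<Longrightarrow> j * n + b < Suc \<epsilon> * n"
    "\<And>i a. i < \<epsilon> \<Longrightarrow> a < n \<Longrightarrow> i * n + a < \<epsilon> * n" "\<And>j b. j < \<eta> \<Longrightarrow> b < n \<Longrightarrow> j * n + b < \<eta> * n"
    by (simp_all only: block_index_less)
  have L: "kronecker (L_mat \<epsilon> ?q) (1\<^sub>m n) \<in> carrier_mat (\<epsilon> * n) (Suc \<epsilon> * n)"
    "kronecker (transpose_mat (L_mat \<eta> ?q)) (1\<^sub>m n) \<in> carrier_mat (Suc \<eta> * n) (\<eta> * n)"
    by (auto simp: kronecker_def L_mat_def)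
  have Mc: "coeff (m i a j b) t = mpoly_coeff M t $$ (i * n + a, j * n + b)"
    if "i < Suc \<eta>" "j < Suc \<epsilon>" "a < n" "b < n" for i j a b t
    using that M idx(1)[of i a] idx(2)[of j b] by (simp only: mpoly_coeff_def m_def carrier_matD index_map_mat)
  have "block_kronecker_form n l \<epsilon> \<eta> P Q m"
  proof
    show "P \<in> carrier_mat n n" by (rule P)
    show "Q \<in> carrier_mat ((\<epsilon> + \<eta> + 1) * n) ((\<epsilon> + \<eta> + 1) * n)"
    proof (rule carrier_matI)
      show "dim_row Q = (\<epsilon> + \<eta> + 1) * n" "dim_col Q = (\<epsilon> + \<eta> + 1) * n"
        unfolding Q index_mat_four_block using M by (auto simp: algebra_simps)
    qed
  next
    fix a b assume ab: "a < n" "b < n"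
    have AM: "(?A * M) $$ (a, k) = (\<Sum>i<Suc \<eta>. ?q ^ (\<eta> - i) * M $$ (i * n + a, k))" if k: "k < Suc \<epsilon> * n" for k
    proof -
      have "(?A * M) $$ (a, k) = (\<Sum>k'<Suc \<eta> * n. ?A $$ (a, k') * M $$ (k', k))"
        by (rule mult_mat_index[OF A M ab(1) k])
      also have "\<dots> = (\<Sum>i<Suc \<eta>. \<Sum>a'<n. if a' = a then ?q ^ (\<eta> - i) * M $$ (i * n + a, k) else 0)"
        unfolding sum_blocks by (intro sum.cong refl) (auto simp: A_entry ab)
      finally show ?thesis using ab by (simp only: sum.delta finite_lessThan lessThan_iff if_True)
    qed
    have "P $$ (a, b) = (?A * M * ?B) $$ (a, b)" by (simp only: Pprod)
    also have "\<dots> = (\<Sum>k<Suc \<epsilon> * n. (?A * M) $$ (a, k) * ?B $$ (k, b))"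
      by (rule mult_mat_index[OF mult_carrier_mat[OF A M] B ab])
    also have "\<dots> = (\<Sum>j<Suc \<epsilon>. \<Sum>b'<n. if b' = b then (?A * M) $$ (a, j * n + b) * ?q ^ (\<epsilon> - j) else 0)"
      unfolding sum_blocks by (intro sum.cong refl) (auto simp only: B_entry ab lessThan_iff mult_zero_right split: if_splits)
    also have "\<dots> = (\<Sum>j<Suc \<epsilon>. (?A * M) $$ (a, j * n + b) * ?q ^ (\<epsilon> - j))"
      using ab by (simp only: sum.delta finite_lessThan lessThan_iff if_True)
    also have "\<dots> = (\<Sum>j<Suc \<epsilon>. \<Sum>i<Suc \<eta>. ?q ^ (\<eta> - i) * m i a j b * ?q ^ (\<epsilon> - j))"
      by (intro sum.cong refl) (simp only: AM idx ab lessThan_iff sum_distrib_right m_def)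
    finally show "P $$ (a, b) = (\<Sum>i<Suc \<eta>. \<Sum>j<Suc \<epsilon>. ?q ^ (\<eta> - i) * m i a j b * ?q ^ (\<epsilon> - j))"
      by (subst sum.swap)
  next
    fix i j a b assume h: "i < Suc \<eta>" "j < Suc \<epsilon>" "a < n" "b < n"
    show "Q $$ (i * n + a, j * n + b) = m i a j b"
      using M idx(1)[of i a] idx(2)[of j b] h unfolding Q m_def
      by (subst index_mat_four_block) auto
  next
    fix i j a b assume h: "i < Suc \<eta>" "j < \<eta>" "a < n" "b < n"
    have "Q $$ (i * n + a, (Suc \<epsilon> + j) * n + b) = kronecker (transpose_mat (L_mat \<eta> ?q)) (1\<^sub>m n) $$ (i * n + a, j * n + b)"
      using M idx(1)[of i a] idx(4)[of j b] h unfolding Q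
      by (subst index_mat_four_block) (auto simp: algebra_simps)
    also have "\<dots> = (if a = b then transpose_mat (L_mat \<eta> ?q) $$ (i, j) else 0)"
      by (rule kronecker_one_mat_index) (use h in \<open>auto simp: L_mat_def\<close>)
    also have "transpose_mat (L_mat \<eta> ?q) $$ (i, j) = (if i = j then - 1 else if i = Suc j then ?q else 0)"
      using h by (simp add: L_mat_def)
    finally show "Q $$ (i * n + a, (Suc \<epsilon> + j) * n + b)
      = (if a = b then if i = j then - 1 else if i = Suc j then ?q else 0 else 0)" .
  next
    fix i j a b assume h: "i < \<epsilon>" "j < Suc \<epsilon>" "a < n" "b < n"
    have "Q $$ ((Suc \<eta> + i) * n + a, j * n + b) = kronecker (L_mat \<epsilon> ?q) (1\<^sub>m n) $$ (i * n + a, j * n + b)"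
      using M idx(3)[of i a] idx(2)[of j b] h unfolding Q
      by (subst index_mat_four_block) (auto simp: algebra_simps)
    also have "\<dots> = (if a = b then L_mat \<epsilon> ?q $$ (i, j) else 0)"
      by (rule kronecker_one_mat_index) (use h in \<open>auto simp: L_mat_def\<close>)
    also have "L_mat \<epsilon> ?q $$ (i, j) = (if j = i then - 1 else if j = Suc i then ?q else 0)"
      using h by (simp add: L_mat_def)
    finally show "Q $$ ((Suc \<eta> + i) * n + a, j * n + b)
      = (if a = b then if j = i then - 1 else if j = Suc i then ?q else 0 else 0)" .
  next
    fix i j a b assume h: "i < \<epsilon>" "j < \<eta>" "a < n" "b < n"
    show "Q $$ ((Suc \<eta> + i) * n + a, (Suc \<epsilon> + j) * n + b) = 0"
      using M idx(3)[of i a] idx(4)[of j b] h unfolding Q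
      by (subst index_mat_four_block) (auto simp: algebra_simps)
  next
    fix i j a b t assume h: "i < Suc \<eta>" "j < Suc \<epsilon>" "a < n" "b < n" "l < t"
    show "coeff (m i a j b) t = 0"
      unfolding Mc[OF h(1-4)] Mdeg[OF h(5)] using h idx by simp
  next
    fix i j t assume h: "i < Suc \<eta>" "j < Suc \<epsilon>" "t \<le> l"
    have entry: "mat n n (\<lambda>(a, b). coeff (m i a j b) t) = mat_block n (mpoly_coeff M t) i j"
      by (rule eq_matI) (auto simp: mat_block_def Mc h)
    have zero: "0\<^sub>m n n = mat n n (\<lambda>(a, b). if a = b then 0 else 0)"
      and one: "1\<^sub>m n = mat n n (\<lambda>(a, b). if a = b then 1 else 0)"
      by (auto intro!: eq_matI)
    have "mat_norm2 (0\<^sub>m n n) \<le> 1" "mat_norm2 (1\<^sub>m n) \<le> 1"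
      unfolding zero one by (rule mat_norm2_scalar_mat, simp)+
    then have "mat_norm2 (mat_block n (mpoly_coeff M t) i j) \<le> 1"
      using blocks[of t i j] h norms by auto
    then show "mat_norm2 (mat n n (\<lambda>(a, b). coeff (m i a j b) t)) \<le> 1" unfolding entry .
  qed
  with dims show thesis by (rule that[rotated])
qed

text \<open>Both Lambda factors are 1 and the L blocks are empty, so \<open>P\<close> and
  \<open>Q\<close> have the same entry \<open>m 0 a 0 b\<close>.\<close>

lemma (in block_kronecker_form) single_block:
  assumes "\<epsilon> = 0" "\<eta> = 0"
  shows "Q = P"
proof (rule eq_matI)
  fix a b assume "a < dim_row P" "b < dim_col P"
  then have ab: "a < n" "b < n" using P_carrier by auto
  show "Q $$ (a, b) = P $$ (a, b)"
    using Q_11[of 0 0 a b] P_entry[OF ab] ab assms by simp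
qed (use P_carrier Q_carrier assms in auto)

theorem theorem6p2:
  fixes d :: nat
  assumes "d \<ge> 1"
  shows "\<exists>c C :: real. c > 0 \<and> C > 0 \<and>
    (\<forall>(n :: nat) (l :: nat) (r :: nat) (P :: complex poly mat)
       (L :: complex poly mat) (R :: complex poly mat) (x :: complex).
       P \<in> carrier_mat n n \<and> mpoly_regular P \<and> mpoly_has_degree P d \<and>
       l \<ge> 1 \<and> l dvd d \<and> r \<ge> 1 \<and> r dvd d \<and>
       (l = d \<longleftrightarrow> r = d) \<and>
       block_kronecker_companion d n l P L \<and>
       block_kronecker_companion d n r P R \<and>
       Max ((\<lambda>i. mat_norm2 (mpoly_coeff P i)) ` {0..d}) = 1 \<and>
       x \<noteq> 0 \<and> simple_mpoly_eigenvalue P x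
       \<longrightarrow>
       (\<forall>zL wL zR wR.
          right_eigenvector L x zL \<and> left_eigenvector L x wL \<and>
          right_eigenvector R x zR \<and> left_eigenvector R x wR
          \<longrightarrow>
          c \<le> coeff_cond r R x zR wR / coeff_cond l L x zL wL \<and>
          coeff_cond r R x zR wR / coeff_cond l L x zL wL \<le> C))"
proof -
  \<comment> \<open>The factor (d + 1) d^2 comes from the weighted norm sum, the squared factor from
    the growth of the right and the left eigenvector.\<close>
  define K where "K = real (Suc d) * (real d)\<^sup>2 * (real d + real d ^ 3 * real (Suc d))\<^sup>2"
  \<comment> \<open>\<open>K\<close> is at least 1, so that [1/K, K] also contains the exact ratio 1
    of the case L = R = P.\<close>
  have "1 + 0 \<le> real d + real d ^ 3 * real (Suc d)"
    using assms by (intro add_mono) auto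
  then have "1 * 1\<^sup>2 * 1\<^sup>2 \<le> K"
    unfolding K_def using assms by (intro mult_mono power_mono) auto
  then have K1: "1 \<le> K" by simp
  have bounds: "1 / K \<le> coeff_cond r R x zR wR / coeff_cond l L x zL wL \<and>
      coeff_cond r R x zR wR / coeff_cond l L x zL wL \<le> K"
    if P: "P \<in> carrier_mat n n" and l: "1 \<le> l" "l dvd d" and r: "1 \<le> r" "r dvd d" and lr: "l = d \<longleftrightarrow> r = d"
      and L: "block_kronecker_companion d n l P L" and R: "block_kronecker_companion d n r P R"
      and scaled: "Max ((\<lambda>i. mat_norm2 (mpoly_coeff P i)) ` {0..d}) = 1"
      and x: "x \<noteq> 0" and simple: "simple_mpoly_eigenvalue P x"
      and zL: "right_eigenvector L x zL" and wL: "left_eigenvector L x wL"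
      and zR: "right_eigenvector R x zR" and wR: "left_eigenvector R x wR"
    for n l r P L R x zL wL zR wR
  proof -
    have norms: "mat_norm2 (mpoly_coeff P k) \<le> 1" if "k \<le> d" for k
      using Max_ge[of "(\<lambda>i. mat_norm2 (mpoly_coeff P i)) ` {0..d}" "mat_norm2 (mpoly_coeff P k)"] that scaled by auto
    obtain \<epsilon> \<eta> m where formL: "block_kronecker_form n l \<epsilon> \<eta> P L m" and dimL: "\<epsilon> + \<eta> + 1 = d div l"
      using block_kronecker_companionE[OF L P norms] by blast
    obtain \<epsilon>' \<eta>' m' where formR: "block_kronecker_form n r \<epsilon>' \<eta>' P R m'" and dimR: "\<epsilon>' + \<eta>' + 1 = d div r"
      using block_kronecker_companionE[OF R P norms] by blast
    have d: "0 < d" "0 < l" "0 < r" using assms l r by auto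
    show ?thesis
    proof (cases "l = d")
      case True
      then have r_eq: "r = d" using lr by simp
      have eqL: "L = P" using block_kronecker_form.single_block[OF formL] dimL True d by simp
      have eqR: "R = P" using block_kronecker_form.single_block[OF formR] dimR r_eq d by simp
      define S where "S = (\<Sum>t\<le>d. cmod x ^ t * mat_norm2 (mpoly_coeff P t))"
      note zDL = right_eigenvectorD[OF P zL[unfolded eqL]] and wDL = left_eigenvectorD[OF P wL[unfolded eqL]]
      note zDR = right_eigenvectorD[OF P zR[unfolded eqR]] and wDR = left_eigenvectorD[OF P wR[unfolded eqR]]
      have nullL: "null_pair n P x (\<lambda>k. cnj (wL $ k)) (\<lambda>k. zL $ k)"
        using zDL wDL by (simp add: null_pair_def)
      have nullR: "null_pair n P x (\<lambda>k. cnj (wR $ k)) (\<lambda>k. zR $ k)"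
        using zDR wDR by (simp add: null_pair_def)
      have condL: "coeff_cond l L x zL wL = S * eigen_factor n P x (\<lambda>k. cnj (wL $ k)) (\<lambda>k. zL $ k)"
        unfolding eqL True S_def eigen_factor_def by (rule coeff_cond_eq[OF P zDL(1) wDL(1)])
      have condR: "coeff_cond r R x zR wR = S * eigen_factor n P x (\<lambda>k. cnj (wR $ k)) (\<lambda>k. zR $ k)"
        unfolding eqR r_eq S_def eigen_factor_def by (rule coeff_cond_eq[OF P zDR(1) wDR(1)])
      \<comment> \<open>To cancel \<open>S\<close> it must be positive: by the scaling some
        coefficient has norm 1, and \<open>x\<close> is nonzero.\<close>
      have "1 \<in> (\<lambda>i. mat_norm2 (mpoly_coeff P i)) ` {0..d}"
        unfolding scaled[symmetric] by (rule Max_in) auto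
      then obtain k where k: "k \<le> d" "mat_norm2 (mpoly_coeff P k) = 1" by auto
      have "cmod x ^ k * mat_norm2 (mpoly_coeff P k) \<le> S"
        unfolding S_def using k by (intro member_le_sum mult_nonneg_nonneg mat_norm2_nonneg) auto
      moreover have "0 < cmod x ^ k * mat_norm2 (mpoly_coeff P k)" using k x by simp
      ultimately have S: "0 < S" by linarith
      have "coeff_cond r R x zR wR / coeff_cond l L x zL wL = 1"
        unfolding condL condR eigen_factor_unique[OF P simple nullL nullR]
        using S eigen_factor_pos[OF P simple x nullL] by simp
      then show ?thesis using K1 by simp
    next
      case False
      have several_blocks: "0 < a + b" if "a + b + 1 = d div q" "q dvd d" "q \<noteq> d" for a b q
      proof (rule gr0I)
        assume "a + b = 0"
        then have "d div q = 1" using that(1) by linarith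
        then show False using dvd_mult_div_cancel[OF that(2)] that(3) by simp
      qed
      have blocksL: "0 < \<epsilon> + \<eta>" using several_blocks[OF dimL l(2) False] .
      \<comment> \<open>Here \<open>l = d \<longleftrightarrow> r = d\<close> guarantees that the
        second form has identity blocks as well.\<close>
      have blocksR: "0 < \<epsilon>' + \<eta>'" using several_blocks[OF dimR r(2)] False lr by blast
      define X where "X = max 1 (cmod x) ^ d"
      obtain u v \<tau> where nullL: "null_pair n P x u v" and condL: "coeff_cond l L x zL wL = \<tau> * eigen_factor n P x u v"
        and \<tau>: "X \<le> \<tau>" "\<tau> \<le> K * X"
        using block_kronecker_form.coeff_cond_bounds[OF formL d(1,2) l(2) dimL blocksL zL wL]
        unfolding X_def K_def by blast
      obtain u' v' \<sigma> where nullR: "null_pair n P x u' v'" and condR: "coeff_cond r R x zR wR = \<sigma> * eigen_factor n P x u' v'"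
        and \<sigma>: "X \<le> \<sigma>" "\<sigma> \<le> K * X"
        using block_kronecker_form.coeff_cond_bounds[OF formR d(1,3) r(2) dimR blocksR zR wR]
        unfolding X_def K_def by blast
      have X: "0 < X" by (simp add: X_def)
      have quotient: "coeff_cond r R x zR wR / coeff_cond l L x zL wL = \<sigma> / \<tau>"
        unfolding condL condR eigen_factor_unique[OF P simple nullL nullR]
        using eigen_factor_pos[OF P simple x nullL] by simp
      have pos: "0 < \<tau>" "0 < K" using X \<tau> K1 by linarith+
      \<comment> \<open>Both numbers lie between \<open>X\<close> and \<open>K * X\<close>, an
        interval that depends on \<open>P\<close>'s degree and on \<open>x\<close> but on neither
        form.\<close>
      have "\<tau> \<le> K * \<sigma>" using \<tau>(2) mult_left_mono[OF \<sigma>(1), of K] pos by linarith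
      moreover have "\<sigma> \<le> K * \<tau>" using \<sigma>(2) mult_left_mono[OF \<tau>(1), of K] pos by linarith
      ultimately show ?thesis unfolding quotient using pos by (simp add: field_simps)
    qed
  qed
  show ?thesis
  proof (rule exI[of _ "1 / K"], rule exI[of _ K], intro conjI allI impI; (elim conjE)?)
    show "0 < 1 / K" "0 < K" using K1 by auto
  qed (use bounds in blast)+
qed

end
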